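(* Let $G$ be a plane graph with positive edge weights, let $X$ be an ISP subgraph of $G$, let $f$ be any face of $X$, and let $a,b$ be two distinct vertices of $R_{\partial f}$. Then for every simple $a$-$b$ path $\pi$ in $G$ we have $w(\pi\downarrow \partial f)\le w(\pi)$.
   Context: A plane graph is a planar graph with a fixed planar embedding; $f^\infty_G$ is its infinite face, and for a face $f$, $\partial f$ is its boundary cycle. For a weighted graph, $w(p)$ is the sum of the weights of the edges of a path $p$. Graph union is $G\cup H=(V(G)\cup V(H),E(G)\cup E(H))$. For a (possibly non-simple) cycle $C$ of $G$, the region bounded by $C$, $R_C$, is the maximal subgraph of $G$ whose external face has $C$ as boundary. For a path $p$ and vertices $u,v$ on it, $p[u,v]$ is the subpath between $u$ and $v$; $\circ$ denotes concatenation of paths. ISP subgraph: a graph $X$ is an incremental shortest paths (ISP) subgraph of $G$ if $X=X_r$ for a sequence $X_0,\ldots,X_r$ of subgraphs of $G$ with $X_0=f^\infty_G$ (the boundary of the infinite face) and $X_i=X_{i-1}\cup p_i$, where $p_i$ is a shortest $x_i$-$y_i$ path in $G$ with $x_i,y_i\in X_{i-1}$. The operator $\downarrow$: let $C$ be a cycle of $G$, $a,b$ vertices of $R_C$ and $\pi$ a simple $a$-$b$ path. If $\pi\subseteq R_C$, then $\pi\downarrow C=\pi$. Otherwise let $(v_1,\ldots,v_{2r})$ be the ordered vertices of $\pi$ such that $\pi[a,v_1]\subseteq R_C$, $\pi[v_{2r},b]\subseteq R_C$, $\pi[v_{2i},v_{2i+1}]\subseteq R_C$ for $i\in[r-1]$,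 and each $\pi[v_{2i-1},v_{2i}]$ lies outside $R_C$ (it shares nothing with $R_C$ besides its endpoints), for $i\in[r]$. For each $i\in[r]$ let $\mu_i$ be the $v_{2i-1}$-$v_{2i}$ path on $C$ such that the region bounded by $\mu_i\circ\pi[v_{2i-1},v_{2i}]$ does not contain $R_C$. Then $\pi\downarrow C=\pi[a,v_1]\circ\mu_1\circ\pi[v_2,v_3]\circ\mu_2\circ\cdots\circ\pi[v_{2r-2},v_{2r-1}]\circ\mu_r\circ\pi[v_{2r},b]$ (possibly a non-simple path). *)

theory Defs
  imports "HOL-Analysis.Analysis"
begin

type_synonym 'v graph = "'v set \<times> 'v set set"

definition plane_graph :: "'v graph \<Rightarrow> ('v \<Rightarrow> complex) \<Rightarrow> ('v set \<Rightarrow> real \<Rightarrow> complex) \<Rightarrow> bool" where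
  "plane_graph G pos c \<longleftrightarrow>
     finite (fst G) \<and> inj_on pos (fst G) \<and>
     (\<forall>e\<in>snd G. \<exists>u v. e = {u, v} \<and> u \<noteq> v \<and> u \<in> fst G \<and> v \<in> fst G \<and>
         arc (c e) \<and> {pathstart (c e), pathfinish (c e)} = {pos u, pos v} \<and>
         path_image (c e) \<inter> pos ` fst G = {pos u, pos v}) \<and>
     (\<forall>e\<in>snd G. \<forall>e'\<in>snd G. e \<noteq> e' \<longrightarrow> path_image (c e) \<inter> path_image (c e') \<subseteq> pos ` (e \<inter> e'))"

definition subgraph :: "'v graph \<Rightarrow> 'v graph \<Rightarrow> bool" where
  "subgraph H K \<longleftrightarrow> fst H \<subseteq> fst K \<and> snd H \<subseteq> snd K"

definition graph_union :: "'v graph \<Rightarrow> 'v graph \<Rightarrow> 'v graph" where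
  "graph_union H K = (fst H \<union> fst K, snd H \<union> snd K)"

definition drawing :: "('v \<Rightarrow> complex) \<Rightarrow> ('v set \<Rightarrow> real \<Rightarrow> complex) \<Rightarrow> 'v graph \<Rightarrow> complex set" where
  "drawing pos c H = pos ` fst H \<union> (\<Union>e\<in>snd H. path_image (c e))"

definition faces :: "('v \<Rightarrow> complex) \<Rightarrow> ('v set \<Rightarrow> real \<Rightarrow> complex) \<Rightarrow> 'v graph \<Rightarrow> complex set set" where
  "faces pos c H = components (- drawing pos c H)"

definition outer_face :: "('v \<Rightarrow> complex) \<Rightarrow> ('v set \<Rightarrow> real \<Rightarrow> complex) \<Rightarrow> 'v graph \<Rightarrow> complex set" where
  "outer_face pos c H = \<Union>{F \<in> faces pos c H. \<not> bounded F}"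

definition face_boundary :: "('v \<Rightarrow> complex) \<Rightarrow> ('v set \<Rightarrow> real \<Rightarrow> complex) \<Rightarrow> 'v graph \<Rightarrow> complex set \<Rightarrow> 'v graph" where
  "face_boundary pos c H F =
     ({v \<in> fst H. pos v \<in> frontier F}, {e \<in> snd H. path_image (c e) \<subseteq> frontier F})"

text \<open>R_C: the maximal subgraph of G whose external face has C as boundary, i.e. all
  vertices and edges of G not lying in the infinite face of C.\<close>
definition region :: "'v graph \<Rightarrow> ('v \<Rightarrow> complex) \<Rightarrow> ('v set \<Rightarrow> real \<Rightarrow> complex) \<Rightarrow> 'v graph \<Rightarrow> 'v graph" where
  "region G pos c C =
     ({v \<in> fst G. pos v \<notin> outer_face pos c C},
      {e \<in> snd G. path_image (c e) \<inter> outer_face pos c C = {}})"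

definition walk_edges :: "'v list \<Rightarrow> 'v set set" where
  "walk_edges xs = {{xs ! i, xs ! Suc i} | i. Suc i < length xs}"

definition walk :: "'v graph \<Rightarrow> 'v list \<Rightarrow> bool" where
  "walk H xs \<longleftrightarrow> xs \<noteq> [] \<and> set xs \<subseteq> fst H \<and> walk_edges xs \<subseteq> snd H"

definition path_graph :: "'v list \<Rightarrow> 'v graph" where
  "path_graph xs = (set xs, walk_edges xs)"

definition weight :: "('v set \<Rightarrow> real) \<Rightarrow> 'v list \<Rightarrow> real" where
  "weight w xs = (\<Sum>i<length xs - 1. w {xs ! i, xs ! Suc i})"

definition shortest_path :: "'v graph \<Rightarrow> ('v set \<Rightarrow> real) \<Rightarrow> 'v list \<Rightarrow> 'v \<Rightarrow> 'v \<Rightarrow> bool" where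
  "shortest_path G w p x y \<longleftrightarrow> walk G p \<and> distinct p \<and> hd p = x \<and> last p = y \<and>
     (\<forall>q. walk G q \<and> hd q = x \<and> last q = y \<longrightarrow> weight w p \<le> weight w q)"

inductive isp :: "'v graph \<Rightarrow> ('v \<Rightarrow> complex) \<Rightarrow> ('v set \<Rightarrow> real \<Rightarrow> complex) \<Rightarrow> ('v set \<Rightarrow> real) \<Rightarrow> 'v graph \<Rightarrow> bool"
  for G pos c w where
  isp_base: "isp G pos c w (face_boundary pos c G (outer_face pos c G))"
| isp_step: "isp G pos c w X \<Longrightarrow> x \<in> fst X \<Longrightarrow> y \<in> fst X \<Longrightarrow> shortest_path G w p x y \<Longrightarrow>
     isp G pos c w (graph_union X (path_graph p))"

text \<open>The operator \<pi>\<down>C, as a relation "down G pos c C \<pi> \<rho>" (\<rho> = \<pi>\<down>C).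
  The path is scanned from its start: edges inside R_C are kept; a maximal
  excursion u, out, v (internal vertices and all edges outside R_C) is replaced by
  a u-v path mu on C such that the region bounded by mu and the excursion
  does not contain R_C.\<close>
inductive down :: "'v graph \<Rightarrow> ('v \<Rightarrow> complex) \<Rightarrow> ('v set \<Rightarrow> real \<Rightarrow> complex) \<Rightarrow> 'v graph \<Rightarrow> 'v list \<Rightarrow> 'v list \<Rightarrow> bool"
  for G pos c C where
  down_end: "v \<in> fst (region G pos c C) \<Longrightarrow> down G pos c C [v] [v]"
| down_in: "u \<in> fst (region G pos c C) \<Longrightarrow> {u, v} \<in> snd (region G pos c C) \<Longrightarrow>
     down G pos c C (v # rest) \<rho> \<Longrightarrow> down G pos c C (u # v # rest) (u # \<rho>)"
| down_out: "u \<in> fst (region G pos c C) \<Longrightarrow> v \<in> fst (region G pos c C) \<Longrightarrow>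
     set out \<inter> fst (region G pos c C) = {} \<Longrightarrow>
     walk_edges (u # out @ [v]) \<inter> snd (region G pos c C) = {} \<Longrightarrow>
     walk C mu \<Longrightarrow> distinct mu \<Longrightarrow> hd mu = u \<Longrightarrow> last mu = v \<Longrightarrow>
     \<not> subgraph (region G pos c C)
         (region G pos c (graph_union (path_graph mu) (path_graph (u # out @ [v])))) \<Longrightarrow>
     down G pos c C (v # rest) \<rho> \<Longrightarrow> down G pos c C (u # out @ v # rest) (mu @ tl \<rho>)"

end

theory Submission
  imports Defs "HOL-Complex_Analysis.Contour_Integration"
begin

text \<open>
  Measure a set \<open>B\<close> of faces of \<open>G\<close> by its perimeter, the total weight of the edges with exactly one
  side in \<open>B\<close>. Perimeter is submodular, and perimeter edge sets meet every vertex cut evenly, so for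
  such a set \<open>Z\<close> and a shortest \<open>x\<close>-\<open>y\<close> path \<open>p\<close> the symmetric difference of \<open>Z\<close> and \<open>p\<close> still
  joins \<open>x\<close> to \<open>y\<close>; hence \<open>w (Z \<inter> p) \<le> w (Z - p)\<close>. By induction along the construction of \<open>X\<close>, every
  bounded face \<open>F\<close> of \<open>X\<close> minimises the perimeter among all sets of bounded faces of \<open>G\<close> that contain
  it: intersecting with the old face \<open>F'\<close> containing \<open>F\<close> does not increase the perimeter by submodularity, and inside
  \<open>F'\<close> the inequality for the new path applies, because edges of the old graph are never
  surrounded by a single bounded face. Adding to \<open>F\<close> the inside of the closed curve formed by an
  excursion and its replacement \<open>\<mu>\<close> exchanges \<open>\<mu>\<close> for the excursion on the perimeter, so \<open>\<mu>\<close> is not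
  heavier than the excursion.
\<close>

section \<open>Arcs in the plane\<close>

text \<open>Edges are arbitrary arcs, so even the claim that an edge has one or two sides needs
  plane topology; most of it comes from Janiszewski's theorem. With at most two sides per edge,
  perimeters add modulo 2 under symmetric difference of face sets. They meet cuts evenly because
  cycles can be peeled off by toggling the faces inside them, and a nonempty perimeter cannot be a
  forest, as forests do not separate the plane. Competing face sets must omit the unbounded face,
  since the set of all faces has perimeter zero. In the inductive step let \<open>R\<close> be the
  faces in \<open>F\<close> and \<open>B1\<close> the competitor cut down to \<open>F'\<close>.
  Edges shared by the perimeters of \<open>R\<close> and \<open>B1 - R\<close> vanish from that of
  \<open>B1\<close> and must be paid for by the rest of the perimeter of \<open>B1 - R\<close>. The
  shortest path inequality does this only if all shared edges lie on the new path, so old edges must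
  not have all sides in \<open>F'\<close>. This holds because each edge of \<open>X\<close> lies on
  the outer boundary or on a cycle of \<open>X\<close>. As \<open>G\<close> may be disconnected,
  connectivity of \<open>X\<close> is claimed only between vertices joined in
  \<open>G\<close>.\<close>

lemma interior_arc_empty:
  fixes g :: "real \<Rightarrow> complex"
  assumes "arc g"
  shows "interior (path_image g) = {}"
proof (rule ccontr)
  assume "interior (path_image g) \<noteq> {}"
  then obtain x r where r: "r > 0" and sub: "ball x r \<subseteq> path_image g"
    by (meson ex_in_conv mem_interior)
  obtain h where h: "homeomorphism {0..1} (path_image g) g h"
    using assms homeomorphism_arc by blast
  have "\<not> finite (ball x r)"
    using r by (metis finite_imp_not_open open_ball centre_in_ball empty_iff)
  moreover have "inj_on h (ball x r)"
    using h sub by (intro inj_on_inverseI[of _ g]) (auto simp: homeomorphism_def)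
  ultimately have "\<not> finite (h ` ball x r)"
    using finite_imageD by blast
  then obtain S where S: "S \<subseteq> h ` ball x r" "card S = 3" "finite S"
    using infinite_arbitrarily_large by blast
  obtain s m t where smt: "s \<in> S" "m \<in> S" "t \<in> S" "s < m" "m < t"
  proof -
    obtain a b c where "S = {a,b,c}" "a \<noteq> b" "b \<noteq> c" "a \<noteq> c"
      using S(2) card_3_iff by metis
    then show thesis
      using that[of a b c] that[of a c b] that[of b a c] that[of b c a] that[of c a b] that[of c b a]
      by (metis insertCI linorder_neqE_linordered_idom)
  qed
  have hg: "h (g u) = u" "g u \<in> ball x r" if u: "u \<in> S" for u
  proof -
    obtain p where p: "p \<in> ball x r" "u = h p" using u S by auto
    then have "g u = p" using h sub by (auto simp: homeomorphism_def)
    then show "h (g u) = u" "g u \<in> ball x r" using p by auto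
  qed
  \<comment> \<open>A disc stays connected when one point is deleted, but its image under
    \<open>h\<close> is a set of reals, and losing \<open>m\<close> from between \<open>s\<close>
    and \<open>t\<close> disconnects that.\<close>
  have "connected (ball x r - {g m})"
    using connected_open_delete[of "ball x r" "g m"] by simp
  moreover have "continuous_on (ball x r - {g m}) h"
    using h sub by (meson Diff_subset continuous_on_subset homeomorphism_def subset_trans)
  ultimately have con: "connected (h ` (ball x r - {g m}))"
    using connected_continuous_image by blast
  have "s \<in> h ` (ball x r - {g m})" "t \<in> h ` (ball x r - {g m})"
    using hg[of s] hg[of m] hg[of t] smt by (force simp: image_iff)+
  then have "m \<in> h ` (ball x r - {g m})"
    using con smt by (meson connected_iff_interval less_imp_le)
  then obtain p where p: "p \<in> ball x r" "p \<noteq> g m" "m = h p" by blast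
  then have "g m = p" using h sub by (auto simp: homeomorphism_def)
  with p show False by simp
qed

text \<open>Neither the arc nor \<open>A\<close> separates two points of \<open>C\<close> off the
  arc; as the two sets meet in a connected (possibly empty) set, Janiszewski's theorem says that
  their union does not separate them either.\<close>

lemma connected_component_diff_pendant_arc:
  fixes g :: "real \<Rightarrow> complex"
  assumes "closed A" "arc g" "connected (path_image g \<inter> A)" "C \<in> components (- A)"
  shows "connected (C - path_image g)"
proof -
  have "connected_component (C - path_image g) a b"
    if ab: "a \<in> C - path_image g" "b \<in> C - path_image g" for a b
  proof -
    have "connected_component (- path_image g) a b"
      using ab connected_arc_complement[OF assms(2)]
      by (auto simp: connected_component_def)
    moreover have "connected_component (- A) a b"
      using ab in_components_connected[OF assms(4)] in_components_subset[OF assms(4)]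
      by (auto simp: connected_component_def)
    ultimately have "connected_component (- (path_image g \<union> A)) a b"
      using assms by (intro Janiszewski) (auto intro: compact_arc_image)
    then obtain t where t: "connected t" "t \<subseteq> - (path_image g \<union> A)" "a \<in> t" "b \<in> t"
      unfolding connected_component_def by blast
    then have "t \<subseteq> C"
      using components_maximal[OF assms(4) t(1)] ab by blast
    then show ?thesis
      using t unfolding connected_component_def by blast
  qed
  then show ?thesis
    by (simp add: connected_iff_connected_component)
qed

text \<open>If \<open>f\<close> lost contact with the arc before \<open>t'\<close>, a gap from
  \<open>s\<close> to \<open>t'\<close> could be taken out of the obstacle. The initial piece up to
  \<open>s\<close> then hangs on the rest \<open>H\<close> by at most one point and separates
  nothing, so \<open>f\<close> surrounds that piece up to its tip \<open>g s\<close>, which was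
  chosen out of reach.\<close>

lemma arc_subset_closure_component_aux:
  fixes g :: "real \<Rightarrow> complex"
  assumes "closed K" "arc g" "path_image g \<inter> K \<subseteq> {pathstart g, pathfinish g}"
    and f: "f \<in> components (- (K \<union> path_image g))"
    and t: "0 < t" "t < t'" "t' < 1" "g t \<in> closure f"
  shows "g t' \<in> closure f"
proof (rule ccontr)
  assume t': "g t' \<notin> closure f"
  have contg: "continuous_on {0..1} g"
    using assms(2) arc_imp_path path_def by blast
  note contg' = continuous_on_subset[OF contg]
  have inj: "inj_on g {0..1}" using assms(2) by (simp add: arc_def)
  have cl: "closed (K \<union> path_image g)"
    using assms by (simp add: closed_Un closed_arc_image)
  have fsub: "f \<subseteq> - (K \<union> path_image g)" using f in_components_subset by blast
  obtain s where s: "t < s" "s < t'" "\<And>u. s \<le> u \<Longrightarrow> u \<le> t' \<Longrightarrow> g u \<notin> closure f"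
  proof -
    have "open (- closure f)" by auto
    then obtain e where e: "e > 0" "ball (g t') e \<subseteq> - closure f"
      using t' open_contains_ball by blast
    have "t' \<in> {0..1}" using t by auto
    then obtain d where d: "d > 0" "\<And>u. u \<in> {0..1} \<Longrightarrow> dist u t' < d \<Longrightarrow> dist (g u) (g t') < e"
      using contg e(1) unfolding continuous_on_iff by blast
    define s where "s = max ((t + t')/2) (t' - d/2)"
    show thesis
    proof (rule that[of s])
      show "t < s" "s < t'" using t d by (auto simp: s_def less_max_iff_disj)
      fix u assume u: "s \<le> u" "u \<le> t'"
      then have "dist u t' < d" "u \<in> {0..1}" using t d by (auto simp: s_def dist_real_def)
      then have "dist (g u) (g t') < e" using d by blast
      then have "g u \<in> ball (g t') e" by (simp add: dist_commute)
      then show "g u \<notin> closure f" using e by blast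
    qed
  qed
  define H where "H = K \<union> path_image (subpath t' 1 g)"
  have im: "path_image (subpath t' 1 g) = g ` {t'..1}" "path_image (subpath 0 s g) = g ` {0..s}"
    using t s by (auto simp: path_image_subpath)
  have arcs: "arc (subpath t' 1 g)" "arc (subpath 0 s g)"
    using t s assms(2) by (auto intro!: arc_subpath_arc)
  have clH: "closed H" unfolding H_def using assms(1) arcs(1) closed_arc_image by blast
  have K: "g u \<notin> K" if u: "0 < u" "u < 1" for u
  proof
    assume "g u \<in> K"
    moreover have "g u \<in> path_image g" using u unfolding path_image_def by auto
    ultimately have "g u = g 0 \<or> g u = g 1"
      using assms(3) unfolding pathstart_def pathfinish_def by blast
    then show False using that inj by (auto dest!: inj_onD)
  qed
  have notH: "g u \<notin> H" if u: "0 < u" "u \<le> s" for u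
  proof
    assume "g u \<in> H"
    then obtain v where "v \<in> {t'..1}" "g u = g v"
      using K[of u] u s(1,2) t(1-3) unfolding H_def im by (auto simp del: atLeastAtMost_iff)
    then show False using that s t inj by (auto dest!: inj_onD)
  qed
  have int: "path_image (subpath 0 s g) \<inter> H \<subseteq> {g 0}"
  proof
    fix x assume "x \<in> path_image (subpath 0 s g) \<inter> H"
    then obtain u where "0 \<le> u" "u \<le> s" "x = g u" "x \<in> H" unfolding im by auto
    then show "x \<in> {g 0}" using notH[of u] by (cases "u = 0") auto
  qed
  have conint: "connected (path_image (subpath 0 s g) \<inter> H)"
    using int by (metis connected_empty connected_sing subset_singletonD)
  define Cc where "Cc = connected_component_set (- H) (g t)"
  have Cc: "Cc \<in> components (- H)"
    unfolding Cc_def using notH[of t] t s by (intro componentsI) auto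
  have openCc: "open Cc" using Cc clH open_components by blast
  have tCc: "g t \<in> Cc" unfolding Cc_def using notH[of t] t s by auto
  have "connected (g ` {t..s})"
    using t s by (intro connected_continuous_image contg') auto
  then have "g ` {t..s} \<subseteq> Cc"
  proof (rule components_maximal[OF Cc])
    show "g ` {t..s} \<subseteq> - H" using notH t(1) by force
    show "Cc \<inter> g ` {t..s} \<noteq> {}" using tCc s(1) by force
  qed
  then have sCc: "g s \<in> Cc" using s by auto
  have conn: "connected (Cc - path_image (subpath 0 s g))"
    using connected_component_diff_pendant_arc[OF clH arcs(2) conint Cc] .
  have fr: "frontier f \<subseteq> K \<union> path_image g"
    using frontier_of_components_subset[OF f] frontier_complement[of "K \<union> path_image g"] cl
    by (metis frontier_subset_closed subset_trans)
  \<comment> \<open>A frontier point of \<open>f\<close> in \<open>Cc\<close> but off the initial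
    piece would have to lie on the gap, where \<open>closure f\<close> is absent.\<close>
  have disj: "(Cc - path_image (subpath 0 s g)) \<inter> frontier f = {}"
  proof -
    have False if x: "x \<in> Cc" "x \<notin> g ` {0..s}" "x \<in> frontier f" for x
    proof -
      have "x \<notin> H" using x(1) Cc in_components_subset by blast
      then have "x \<notin> K" "x \<notin> g ` {t'..1}" by (auto simp: H_def im)
      then obtain u where u: "x = g u" "u \<in> {0..1}"
        using fr x(3) by (auto simp: path_image_def)
      then have "s \<le> u \<and> u \<le> t'" using x(2) \<open>x \<notin> g ` {t'..1}\<close> by force
      then show False using s(3) u x(3) by (auto simp: frontier_def)
    qed
    then show ?thesis unfolding im by blast
  qed
  have "\<exists>y. y \<in> f \<and> y \<in> Cc"
    using t(4) openCc tCc open_Int_closure_eq_empty[of Cc f] by blast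
  then have "f \<inter> (Cc - path_image (subpath 0 s g)) \<noteq> {}"
    using fsub path_image_subpath_subset[of 0 s g] t s arc_imp_path[OF assms(2)] by fastforce
  then have subf: "Cc - path_image (subpath 0 s g) \<subseteq> f"
    using connected_Int_frontier[OF conn] disj by blast
  have "g s \<in> closure f"
    unfolding closure_iff_nhds_not_empty
  proof (intro allI impI)
    fix A V assume V: "V \<subseteq> A" "open V" "g s \<in> V"
    have "\<not> (V \<inter> Cc \<subseteq> path_image (subpath 0 s g))"
      using interior_maximal[of "V \<inter> Cc"] interior_arc_empty[OF arcs(2)] V openCc sCc by blast
    then show "f \<inter> A \<noteq> {}" using subf V by blast
  qed
  then show False using s by auto
qed

text \<open>The previous lemma runs forward along the arc; reversing the arc gives the other
  direction and continuity adds the ends. Hence face boundaries consist of entire edges.\<close>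

lemma arc_subset_closure_component:
  fixes g :: "real \<Rightarrow> complex"
  assumes "closed K" "arc g" "path_image g \<inter> K \<subseteq> {pathstart g, pathfinish g}"
    and f: "f \<in> components (- (K \<union> path_image g))"
    and t: "0 < t" "t < 1" "g t \<in> closure f"
  shows "path_image g \<subseteq> closure f"
proof -
  have *: "g u \<in> closure f" if u: "0 < u" "u < 1" for u
  proof -
    consider "u = t" | "t < u" | "u < t" by linarith
    then show ?thesis
    proof cases
      case 2
      then show ?thesis using arc_subset_closure_component_aux[OF assms(1-4), of t u] t u by auto
    next
      case 3
      have "reversepath g (1 - u) \<in> closure f"
      proof (rule arc_subset_closure_component_aux[of K _ _ "1 - t"])
        show "reversepath g (1 - t) \<in> closure f" using t by (simp add: reversepath_def)
      qed (use assms 3 u in \<open>auto simp: arc_reversepath insert_commute\<close>)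
      then show ?thesis by (simp add: reversepath_def)
    qed (use t in auto)
  qed
  have "continuous_on (closure {0<..<1::real}) g"
    using assms(2) arc_imp_path path_def by auto
  then have "g ` closure {0<..<1} \<subseteq> closure f"
    by (rule image_closure_subset) (use * in auto)
  then show ?thesis by (simp add: path_image_def)
qed

text \<open>\<open>P\<close> labels the side of the arc: near \<open>g t\<close>, equal labels force
  equal components, while different labels promise nothing, as for a bridge. The label comes from a
  crosscut of a disc around \<open>g t\<close>, which cuts the disc into two Jordan domains.\<close>

lemma arc_two_sided:
  fixes g :: "real \<Rightarrow> complex"
  assumes "closed K" "arc g" and gK: "path_image g \<inter> K \<subseteq> {pathstart g, pathfinish g}"
    and t: "0 < t" "t < 1"
  obtains r and P :: "complex \<Rightarrow> bool" where "r > 0"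
    "\<And>p q. p \<in> ball (g t) r - (K \<union> path_image g) \<Longrightarrow> q \<in> ball (g t) r - (K \<union> path_image g)
      \<Longrightarrow> P p = P q \<Longrightarrow> connected_component (- (K \<union> path_image g)) p q"
proof -
  have contg: "continuous_on {0..1} g"
    using assms(2) arc_imp_path path_def by blast
  note contg' = continuous_on_subset[OF contg]
  have inj: "inj_on g {0..1}" using assms(2) by (simp add: arc_def)
  define z where "z = g t"
  \<comment> \<open>Half the distance to the nearer end, so that the arc leaves the disc in both
    directions from \<open>t\<close>.\<close>
  define \<rho> where "\<rho> = min (dist (g 0) z) (dist (g 1) z) / 2"
  have "g 0 \<noteq> z" "g 1 \<noteq> z"
    using inj t unfolding z_def by (auto dest!: inj_onD)
  then have "dist (g 0) z > 0" "dist (g 1) z > 0" by auto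
  then have \<rho>: "\<rho> > 0" "\<rho> < dist (g 0) z" "\<rho> < dist (g 1) z"
    unfolding \<rho>_def by linarith+
  define d where "d = (\<lambda>u. dist (g u) z)"
  have contd: "continuous_on {0..1} d"
    unfolding d_def by (intro continuous_intros contg)
  have dt: "d t = 0" unfolding d_def z_def by simp
  \<comment> \<open>The last parameter before \<open>t\<close> on the circle; \<open>b\<close> below
    is the first one after \<open>t\<close>. Between them the arc stays in the open disc, so it is a
    crosscut.\<close>
  obtain a where a: "0 < a" "a < t" "d a = \<rho>" "\<And>u. a < u \<Longrightarrow> u \<le> t \<Longrightarrow> d u < \<rho>"
  proof -
    define A where "A = {0..t} \<inter> d -` {\<rho>..}"
    have "continuous_on {0..t} d" by (rule continuous_on_subset[OF contd]) (use t in auto)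
    then have "closed A" unfolding A_def by (intro continuous_closed_preimage) auto
    then have "compact A" unfolding A_def by (metis compact_Icc compact_Int_closed inf.absorb_iff2 inf_le1)
    moreover have "0 \<in> A" using t \<rho> by (auto simp: A_def d_def)
    ultimately obtain a where a: "a \<in> A" "\<And>u. u \<in> A \<Longrightarrow> u \<le> a"
      using compact_attains_sup[of A] by blast
    have at: "a < t" using a(1) dt \<rho> by (auto simp: A_def order_le_less)
    have 1: "d u < \<rho>" if "a < u" "u \<le> t" for u
    proof (rule ccontr)
      assume "\<not> d u < \<rho>"
      then have "u \<in> A" using that a(1) by (auto simp: A_def)
      then show False using a(2) that by fastforce
    qed
    have "\<exists>u. a \<le> u \<and> u \<le> t \<and> d u = \<rho>"
      using a(1) at dt \<rho> t by (intro IVT2' continuous_on_subset[OF contd]) (auto simp: A_def)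
    then have "d a = \<rho>" using 1 by (metis order_le_less less_irrefl)
    moreover have "a \<noteq> 0" using \<open>d a = \<rho>\<close> \<rho> by (auto simp: d_def)
    ultimately show thesis using that[of a] 1 at a(1) by (auto simp: A_def)
  qed
  obtain b where b: "t < b" "b < 1" "d b = \<rho>" "\<And>u. t \<le> u \<Longrightarrow> u < b \<Longrightarrow> d u < \<rho>"
  proof -
    define A where "A = {t..1} \<inter> d -` {\<rho>..}"
    have "continuous_on {t..1} d" by (rule continuous_on_subset[OF contd]) (use t in auto)
    then have "closed A" unfolding A_def by (intro continuous_closed_preimage) auto
    then have "compact A" unfolding A_def by (metis compact_Icc compact_Int_closed inf.absorb_iff2 inf_le1)
    moreover have "1 \<in> A" using t \<rho> by (auto simp: A_def d_def)
    ultimately obtain b where b: "b \<in> A" "\<And>u. u \<in> A \<Longrightarrow> b \<le> u"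
      using compact_attains_inf[of A] by blast
    have tb: "t < b" using b(1) dt \<rho> by (auto simp: A_def order_le_less)
    have 1: "d u < \<rho>" if "t \<le> u" "u < b" for u
    proof (rule ccontr)
      assume "\<not> d u < \<rho>"
      then have "u \<in> A" using that b(1) by (auto simp: A_def)
      then show False using b(2) that by fastforce
    qed
    have "\<exists>u. t \<le> u \<and> u \<le> b \<and> d u = \<rho>"
      using b(1) tb dt \<rho> t by (intro IVT' continuous_on_subset[OF contd]) (auto simp: A_def)
    then have "d b = \<rho>" using 1 by (metis order_le_less less_irrefl)
    moreover have "b \<noteq> 1" using \<open>d b = \<rho>\<close> \<rho> by (auto simp: d_def)
    ultimately show thesis using that[of b] 1 tb b(1) by (auto simp: A_def)
  qed
  have dle: "d u < \<rho>" if "a < u" "u < b" for u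
    using a(4) b(4) that by (metis le_cases)
  define cc where "cc = subpath a b g"
  have imcc: "path_image cc = g ` {a..b}" unfolding cc_def using a b by (simp add: path_image_subpath)
  have arccc: "arc cc" unfolding cc_def using a b t assms(2) by (intro arc_subpath_arc) auto
  have ends: "pathstart cc = g a" "pathfinish cc = g b" by (auto simp: cc_def)
  have gab: "g a \<noteq> g b" using inj a b t by (auto dest!: inj_onD)
  \<comment> \<open>The remaining pieces of the arc may re-enter the disc, so they count as obstacle
    together with \<open>K\<close>; only the smaller ball of radius \<open>r\<close> will avoid
    them.\<close>
  define K2 where "K2 = K \<union> g ` {0..a} \<union> g ` {b..1}"
  have clK2: "closed K2"
    unfolding K2_def using a b t assms(1)
    by (intro closed_Un compact_imp_closed[OF compact_continuous_image] contg') auto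
  have whole: "K2 \<union> path_image cc = K \<union> path_image g"
  proof -
    have "{0..1} = {0..a} \<union> {a..b} \<union> {b..1}" using a b t by auto
    then show ?thesis unfolding K2_def imcc unfolding path_image_def by (metis image_Un sup.assoc sup.commute)
  qed
  have gK': "g u \<notin> K" if u: "0 < u" "u < 1" for u
  proof
    assume "g u \<in> K"
    moreover have "g u \<in> path_image g" using u unfolding path_image_def by auto
    ultimately have "g u = g 0 \<or> g u = g 1"
      using gK unfolding pathstart_def pathfinish_def by blast
    then show False using that inj by (auto dest!: inj_onD)
  qed
  have K2cc: "g u \<notin> K2" if u: "a < u" "u < b" for u
  proof
    assume "g u \<in> K2"
    then obtain v where "v \<in> {0..a} \<union> {b..1}" "g u = g v"
      using gK'[of u] u a(1,2) b(1,2) unfolding K2_def by (auto simp del: atLeastAtMost_iff)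
    then show False using that a b t inj by (auto dest!: inj_onD)
  qed
  have "g a \<in> sphere z \<rho>" "g b \<in> sphere z \<rho>" using a(3) b(3) by (auto simp: d_def dist_commute)
  then have "g a \<in> path_image (circlepath z \<rho>)" "g b \<in> path_image (circlepath z \<rho>)" using \<rho> by auto
  then obtain c1 c2' where c12: "arc c1" "arc c2'" "pathstart c1 = g a" "pathfinish c1 = g b"
       "pathstart c2' = g b" "pathfinish c2' = g a"
       "path_image c1 \<inter> path_image c2' = {g a, g b}"
       "path_image c1 \<union> path_image c2' = path_image (circlepath z \<rho>)"
    using exists_double_arc[of "circlepath z \<rho>" "g a" "g b"] gab \<rho> by (auto simp: simple_path_circlepath)
  define c2 where "c2 = reversepath c2'"
  have c2: "arc c2" "pathstart c2 = g a" "pathfinish c2 = g b" "path_image c2 = path_image c2'"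
    using c12 by (auto simp: c2_def arc_reversepath)
  have sph: "path_image c1 \<union> path_image c2 = sphere z \<rho>" using c12 c2 \<rho> by simp
  have "inside (frontier (ball z \<rho>)) = interior (ball z \<rho>)"
    by (intro inside_frontier_eq_interior) auto
  then have ins: "inside (path_image c1 \<union> path_image c2) = ball z \<rho>"
    using sph \<rho> by (simp add: interior_open)
  have ccs: "path_image cc \<inter> sphere z \<rho> = {g a, g b}"
  proof -
    have "u = a \<or> u = b" if "a \<le> u" "u \<le> b" "d u = \<rho>" for u
      using dle[of u] that by force
    then have "path_image cc \<inter> sphere z \<rho> \<subseteq> {g a, g b}"
      unfolding imcc by (force simp: d_def dist_commute)
    moreover have "g a \<in> path_image cc" "g b \<in> path_image cc" using a(2) b(1) unfolding imcc by auto
    ultimately show ?thesis using a(3) b(3) by (auto simp: d_def dist_commute)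
  qed
  have c1cc: "path_image c1 \<inter> path_image cc = {g a, g b}"
    using ccs sph c12 by blast
  have c2cc: "path_image c2 \<inter> path_image cc = {g a, g b}"
    using ccs sph c12 c2 by blast
  have zcc: "z \<in> path_image cc" unfolding imcc z_def using a b by auto
  obtain split: "inside (path_image c1 \<union> path_image cc) \<inter> inside (path_image c2 \<union> path_image cc) = {}"
      "inside (path_image c1 \<union> path_image cc) \<union> inside (path_image c2 \<union> path_image cc)
         \<union> (path_image cc - {g a, g b}) = ball z \<rho>"
  proof (rule split_inside_simple_closed_curve[of c1 "g a" "g b" c2 cc])
    show "path_image cc \<inter> inside (path_image c1 \<union> path_image c2) \<noteq> {}"
      using zcc ins \<rho> by auto
  qed (use c12 c2 arccc ends gab c1cc c2cc ins in \<open>auto simp: arc_imp_simple_path\<close>)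
  have key: "connected_component (- (K \<union> path_image g)) p q"
    if J: "arc c" "pathstart c = g a" "pathfinish c = g b" "inside (path_image c \<union> path_image cc) \<subseteq> ball z \<rho>"
          "path_image c \<inter> path_image cc = {g a, g b}" "arc c'" "path_image c' \<inter> path_image cc = {g a, g b}"
          "path_image c' \<subseteq> sphere z \<rho>"
      and pq: "p \<in> inside (path_image c \<union> path_image cc)" "q \<in> inside (path_image c \<union> path_image cc)"
      and B: "p \<in> ball z r" "q \<in> ball z r" "ball z r \<subseteq> ball z \<rho> - K2" for c c' p q r
  proof -
    have simp: "simple_path (c +++ reversepath cc)"
      using J arccc ends by (intro simple_path_join_loop) (auto simp: arc_reversepath)
    have imj: "path_image (c +++ reversepath cc) = path_image c \<union> path_image cc"
      using J ends by (simp add: path_image_join)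
    have con: "connected (inside (path_image c \<union> path_image cc))"
      using Jordan_inside_outside[OF simp] J imj ends by simp
    \<comment> \<open>The crosscut meets the rest of the drawing in two points; adding the opposite circle arc to
      both sets makes the intersection connected.\<close>
    have "connected_component (- ((path_image c' \<union> path_image cc) \<union> (K2 \<union> path_image c'))) p q"
    proof (rule Janiszewski)
      show "compact (path_image c' \<union> path_image cc)"
        using J(6) arccc by (intro compact_Un) (auto intro: compact_arc_image)
      show "closed (K2 \<union> path_image c')"
        using J(6) clK2 by (intro closed_Un) (auto intro: closed_arc_image)
      have "K2 \<inter> path_image cc \<subseteq> {g a, g b}"
      proof
        fix x assume "x \<in> K2 \<inter> path_image cc"
        then obtain u where "a \<le> u" "u \<le> b" "x = g u" "x \<in> K2" unfolding imcc by auto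
        then show "x \<in> {g a, g b}" using K2cc[of u] by (cases "u = a \<or> u = b") auto
      qed
      then have "(path_image c' \<union> path_image cc) \<inter> (K2 \<union> path_image c') = path_image c'"
        using J(7) by blast
      then show "connected ((path_image c' \<union> path_image cc) \<inter> (K2 \<union> path_image c'))"
        using J(6) by (simp add: connected_arc_image)
      have "inside (path_image c \<union> path_image cc) \<subseteq> - (path_image c' \<union> path_image cc)"
        using J(4,8) inside_no_overlap[of "path_image c \<union> path_image cc"] by fastforce
      then show "connected_component (- (path_image c' \<union> path_image cc)) p q"
        using con pq by (meson connected_component_def)
      have "ball z r \<subseteq> - (K2 \<union> path_image c')" using B J(8) by fastforce
      then show "connected_component (- (K2 \<union> path_image c')) p q"
        using B by (meson connected_ball connected_component_def)
    qed
    then show ?thesis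
      by (rule connected_component_of_subset) (use whole in blast)
  qed
  have "z \<notin> K2" using K2cc[of t] a b by (simp add: z_def)
  then have "z \<in> ball z \<rho> - K2" using \<rho> by auto
  moreover have "open (ball z \<rho> - K2)" using clK2 by (intro open_Diff) auto
  ultimately obtain r where r: "r > 0" "ball z r \<subseteq> ball z \<rho> - K2"
    using open_contains_ball by blast
  have in1: "inside (path_image c1 \<union> path_image cc) \<subseteq> ball z \<rho>"
    and in2: "inside (path_image c2 \<union> path_image cc) \<subseteq> ball z \<rho>"
    using split(2) by blast+
  have sub1: "path_image c1 \<subseteq> sphere z \<rho>" and sub2: "path_image c2 \<subseteq> sphere z \<rho>"
    using sph by blast+
  show thesis
  proof (rule that[of r "\<lambda>p. p \<in> inside (path_image c1 \<union> path_image cc)"])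
    fix p q assume pq: "p \<in> ball (g t) r - (K \<union> path_image g)" "q \<in> ball (g t) r - (K \<union> path_image g)"
      "(p \<in> inside (path_image c1 \<union> path_image cc)) = (q \<in> inside (path_image c1 \<union> path_image cc))"
    have pq': "p \<in> ball z r" "q \<in> ball z r" using pq by (auto simp: z_def)
    show "connected_component (- (K \<union> path_image g)) p q"
    proof (cases "p \<in> inside (path_image c1 \<union> path_image cc)")
      case True
      then have q: "q \<in> inside (path_image c1 \<union> path_image cc)" using pq(3) by blast
      show ?thesis
        by (rule key[OF c12(1,3,4) in1 c1cc c2(1) c2cc sub2 True q pq' r(2)])
    next
      case False
      have "path_image cc \<subseteq> K \<union> path_image g" using whole by blast
      then have "p \<in> inside (path_image c2 \<union> path_image cc)" "q \<in> inside (path_image c2 \<union> path_image cc)"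
        using False pq pq' r(2) split(2) by blast+
      then show ?thesis
        using key[OF c2(1-3) in2 c2cc c12(1) c1cc sub1 _ _ pq' r(2)] by blast
    qed
  qed (rule r)
qed

section \<open>Edges of a plane graph and their adjacent faces\<close>

lemma component_absorbs:
  assumes "C \<in> components S" "connected T" "T \<subseteq> S" "T \<inter> C \<noteq> {}"
  shows "T \<subseteq> C"
  using components_maximal[OF assms(1-3)] assms(4) by blast

lemma frontier_component_complement_closed:
  fixes S :: "'a::euclidean_space set"
  assumes "closed S" "C \<in> components (- S)"
  shows "frontier C \<subseteq> S"
  using frontier_of_components_subset[OF assms(2)] assms(1)
  by (metis frontier_complement frontier_subset_closed subset_trans)

locale plane =
  fixes G :: "'v graph" and pos :: "'v \<Rightarrow> complex" and c :: "'v set \<Rightarrow> real \<Rightarrow> complex"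
  assumes plane_graph: "plane_graph G pos c"
begin

abbreviation "D H \<equiv> drawing pos c H"

text \<open>\<open>subgraph\<close> does not make the edge set closed under endpoints; this does, so
  a drawing splits into vertex points and open edges.\<close>

definition wf_sub :: "'v graph \<Rightarrow> bool" where
  "wf_sub H \<longleftrightarrow> fst H \<subseteq> fst G \<and> snd H \<subseteq> snd G \<and> \<Union>(snd H) \<subseteq> fst H"

definition edge_interior :: "'v set \<Rightarrow> complex set" where
  "edge_interior e = path_image (c e) - pos ` e"

text \<open>Contact is tested on the open edge, because at an endpoint many unrelated faces meet. A
  bridge has a single side.\<close>

definition sides :: "'v set \<Rightarrow> complex set set" where
  "sides e = {f \<in> faces pos c G. closure f \<inter> edge_interior e \<noteq> {}}"

text \<open>The perimeter, that is, the modulo 2 boundary of a set of faces. A bridge never belongs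
  to it.\<close>

definition bnd :: "complex set set \<Rightarrow> 'v set set" where
  "bnd B = {e \<in> snd G. sides e \<inter> B \<noteq> {} \<and> \<not> sides e \<subseteq> B}"

definition faces_in :: "complex set \<Rightarrow> complex set set" where
  "faces_in W = {f \<in> faces pos c G. f \<subseteq> W}"

lemma finite_verts: "finite (fst G)"
  using plane_graph by (simp add: plane_graph_def)

lemma inj_pos: "inj_on pos (fst G)"
  using plane_graph by (simp add: plane_graph_def)

lemma edgeE:
  assumes "e \<in> snd G"
  obtains u v where "e = {u, v}" "u \<noteq> v" "u \<in> fst G" "v \<in> fst G" "arc (c e)"
    "pathstart (c e) = pos u" "pathfinish (c e) = pos v" "path_image (c e) \<inter> pos ` fst G = {pos u, pos v}"
proof -
  obtain u v where uv: "e = {u, v}" "u \<noteq> v" "u \<in> fst G" "v \<in> fst G" "arc (c e)"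
     "{pathstart (c e), pathfinish (c e)} = {pos u, pos v}" "path_image (c e) \<inter> pos ` fst G = {pos u, pos v}"
    using plane_graph assms unfolding plane_graph_def by metis
  from uv(6) consider "pathstart (c e) = pos u" "pathfinish (c e) = pos v"
    | "pathstart (c e) = pos v" "pathfinish (c e) = pos u"
    by (auto simp: doubleton_eq_iff)
  then show thesis
  proof cases
    case 1
    then show ?thesis using that[of u v] uv by simp
  next
    case 2
    then show ?thesis using that[of v u] uv by (simp add: insert_commute)
  qed
qed

lemma edge_subset: "e \<in> snd G \<Longrightarrow> e \<subseteq> fst G"
  by (erule edgeE) auto

lemma finite_edges: "finite (snd G)"
  using edge_subset finite_verts by (meson Pow_iff finite_Pow_iff finite_subset subsetI)

lemma wf_sub_G: "wf_sub G"
  using edge_subset by (auto simp: wf_sub_def)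

lemma arc_edge: "e \<in> snd G \<Longrightarrow> arc (c e)"
  by (erule edgeE)

lemma edge_ends: "e \<in> snd G \<Longrightarrow> {pathstart (c e), pathfinish (c e)} = pos ` e"
  by (erule edgeE) auto

lemma edge_verts: "e \<in> snd G \<Longrightarrow> path_image (c e) \<inter> pos ` fst G = pos ` e"
  by (erule edgeE) auto

lemma edges_meet: "e \<in> snd G \<Longrightarrow> e' \<in> snd G \<Longrightarrow> e \<noteq> e' \<Longrightarrow> path_image (c e) \<inter> path_image (c e') \<subseteq> pos ` (e \<inter> e')"
  using plane_graph unfolding plane_graph_def by blast

lemma path_image_edge: "e \<in> snd G \<Longrightarrow> path_image (c e) = edge_interior e \<union> pos ` e"
  using edge_verts[of e] edge_subset[of e] unfolding edge_interior_def by blast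

lemma edge_interior_eq:
  assumes "e \<in> snd G"
  shows "edge_interior e = c e ` {0<..<1}"
proof -
  have inj: "inj_on (c e) {0..1}" using arc_edge[OF assms] by (simp add: arc_def)
  have "edge_interior e = c e ` {0..1} - c e ` {0, 1}"
    unfolding edge_interior_def path_image_def
    using edge_ends[OF assms] by (auto simp: pathstart_def pathfinish_def)
  also have "\<dots> = c e ` ({0..1} - {0, 1})"
    using inj by (intro inj_on_image_set_diff[symmetric]) auto
  also have "{0..1} - {0, 1} = {0<..<1::real}" by auto
  finally show ?thesis .
qed

lemma connected_edge_interior: "e \<in> snd G \<Longrightarrow> connected (edge_interior e)"
  unfolding edge_interior_eq using arc_edge[of e]
  by (intro connected_continuous_image)
     (auto simp: arc_def path_def intro: continuous_on_subset[of "{0..1}"])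

lemma edge_interior_nonempty: "e \<in> snd G \<Longrightarrow> edge_interior e \<noteq> {}"
  by (simp add: edge_interior_eq)

lemma closure_edge_interior:
  assumes "e \<in> snd G"
  shows "path_image (c e) \<subseteq> closure (edge_interior e)"
proof -
  have "continuous_on (closure {0<..<1::real}) (c e)"
    using arc_edge[OF assms] arc_imp_path path_def by auto
  then have "c e ` closure {0<..<1} \<subseteq> closure (edge_interior e)"
    by (rule image_closure_subset) (use edge_interior_eq[OF assms] closure_subset in auto)
  then show ?thesis by (simp add: path_image_def)
qed

lemma edge_interior_verts: "e \<in> snd G \<Longrightarrow> edge_interior e \<inter> pos ` fst G = {}"
  using edge_verts[of e] unfolding edge_interior_def by blast

lemma edge_interior_disjoint:
  "e \<in> snd G \<Longrightarrow> e' \<in> snd G \<Longrightarrow> e \<noteq> e' \<Longrightarrow> edge_interior e \<inter> path_image (c e') = {}"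
  using edges_meet[of e e'] unfolding edge_interior_def by blast

lemma wf_sub_edge: "wf_sub H \<Longrightarrow> e \<in> snd H \<Longrightarrow> e \<in> snd G"
  unfolding wf_sub_def by blast

lemma wf_sub_finite: "wf_sub H \<Longrightarrow> finite (fst H) \<and> finite (snd H)"
  unfolding wf_sub_def
  by (intro conjI finite_subset[OF _ finite_verts] finite_subset[OF _ finite_edges]) auto

lemma drawing_eq: "wf_sub H \<Longrightarrow> D H = pos ` fst H \<union> (\<Union>e\<in>snd H. edge_interior e)"
  using path_image_edge unfolding drawing_def wf_sub_def by fastforce

lemma edge_interior_drawing: "e \<in> snd G \<Longrightarrow> wf_sub H \<Longrightarrow> e \<notin> snd H \<Longrightarrow> edge_interior e \<inter> D H = {}"
  using edge_interior_verts[of e] edge_interior_disjoint[of e]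
  unfolding drawing_def wf_sub_def by blast

lemma compact_drawing: "wf_sub H \<Longrightarrow> compact (D H)"
  unfolding drawing_def using wf_sub_finite[of H] arc_edge
  by (intro compact_Un compact_UN ballI finite_imp_compact[of "pos ` fst H"] compact_arc_image)
     (auto simp: wf_sub_def)

lemma closed_drawing: "wf_sub H \<Longrightarrow> closed (D H)"
  by (simp add: compact_drawing compact_imp_closed)

lemma interior_drawing:
  assumes "wf_sub H"
  shows "interior (D H) = {}"
proof -
  have "interior (\<Union>e\<in>A. path_image (c e)) = {} \<and> closed (\<Union>e\<in>A. path_image (c e))"
    if "finite A" "A \<subseteq> snd G" for A
    using that
  proof (induction A rule: finite_induct)
    case (insert e A)
    have "closed (path_image (c e))" "interior (path_image (c e)) = {}"
      using insert arc_edge[of e] closed_arc_image interior_arc_empty by auto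
    then show ?case
      using insert by (simp add: interior_closed_Un_empty_interior closed_Un)
  qed auto
  then have "interior (\<Union>e\<in>snd H. path_image (c e)) = {}"
    using assms wf_sub_finite[of H] by (auto simp: wf_sub_def)
  moreover have "closed (pos ` fst H)" "interior (pos ` fst H) = {}"
    using wf_sub_finite[OF assms] by (auto simp: finite_imp_closed empty_interior_finite)
  ultimately show ?thesis
    unfolding drawing_def by (simp add: interior_closed_Un_empty_interior)
qed

lemma drawing_inter:
  assumes "wf_sub H" "wf_sub K" "snd H \<inter> snd K = {}"
  shows "D H \<inter> D K = pos ` (fst H \<inter> fst K)"
proof
  show "D H \<inter> D K \<subseteq> pos ` (fst H \<inter> fst K)"
  proof
    fix x assume x: "x \<in> D H \<inter> D K"
    have "x \<notin> edge_interior e" if "e \<in> snd H" for e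
      using edge_interior_drawing[OF wf_sub_edge[OF assms(1) that] assms(2)] that x assms(3) by blast
    moreover have "x \<notin> edge_interior e" if "e \<in> snd K" for e
      using edge_interior_drawing[OF wf_sub_edge[OF assms(2) that] assms(1)] that x assms(3) by blast
    ultimately have "x \<in> pos ` fst H" "x \<in> pos ` fst K"
      using x assms by (auto simp: drawing_eq)
    then show "x \<in> pos ` (fst H \<inter> fst K)"
      using inj_on_image_Int[OF inj_pos, of "fst H" "fst K"] assms by (auto simp: wf_sub_def)
  qed
  show "pos ` (fst H \<inter> fst K) \<subseteq> D H \<inter> D K"
    by (auto simp: drawing_def)
qed

lemma drawing_mono: "fst H \<subseteq> fst K \<Longrightarrow> snd H \<subseteq> snd K \<Longrightarrow> D H \<subseteq> D K"
  unfolding drawing_def by blast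

lemma drawing_subset_G: "wf_sub H \<Longrightarrow> D H \<subseteq> D G"
  by (rule drawing_mono) (auto simp: wf_sub_def)

lemma open_face: "wf_sub H \<Longrightarrow> F \<in> faces pos c H \<Longrightarrow> open F"
  unfolding faces_def using closed_drawing open_components by blast

lemma face_connected: "F \<in> faces pos c H \<Longrightarrow> connected F"
  unfolding faces_def by (rule in_components_connected)

lemma face_disjoint_drawing: "F \<in> faces pos c H \<Longrightarrow> F \<inter> D H = {}"
  unfolding faces_def using in_components_subset by blast

lemma face_nonempty: "F \<in> faces pos c H \<Longrightarrow> F \<noteq> {}"
  unfolding faces_def using in_components_nonempty by blast

lemma faces_eq: "F \<in> faces pos c H \<Longrightarrow> F' \<in> faces pos c H \<Longrightarrow> F \<inter> F' \<noteq> {} \<Longrightarrow> F = F'"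
  unfolding faces_def using components_eq by blast

lemma face_absorbs: "F \<in> faces pos c H \<Longrightarrow> connected T \<Longrightarrow> T \<inter> D H = {} \<Longrightarrow> T \<inter> F \<noteq> {} \<Longrightarrow> T \<subseteq> F"
  unfolding faces_def by (rule component_absorbs) auto

lemma frontier_face: "wf_sub H \<Longrightarrow> F \<in> faces pos c H \<Longrightarrow> frontier F \<subseteq> D H"
  unfolding faces_def using closed_drawing frontier_component_complement_closed by blast

lemma point_in_face: "x \<notin> D H \<Longrightarrow> \<exists>F\<in>faces pos c H. x \<in> F"
  unfolding faces_def using Union_components[of "- D H"] by blast

lemma
  assumes "e \<in> snd G"
  shows drawing_split_edge: "D G = D (fst G, snd G - {e}) \<union> path_image (c e)"
    and edge_meets_rest: "path_image (c e) \<inter> D (fst G, snd G - {e}) \<subseteq> {pathstart (c e), pathfinish (c e)}"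
    and wf_sub_rest: "wf_sub (fst G, snd G - {e})"
proof -
  show wf: "wf_sub (fst G, snd G - {e})"
    using edge_subset by (auto simp: wf_sub_def)
  show "D G = D (fst G, snd G - {e}) \<union> path_image (c e)"
    using assms by (auto simp: drawing_def)
  show "path_image (c e) \<inter> D (fst G, snd G - {e}) \<subseteq> {pathstart (c e), pathfinish (c e)}"
    using edge_interior_drawing[OF assms wf] path_image_edge[OF assms] edge_ends[OF assms] by auto
qed

lemma sides_closure:
  assumes "e \<in> snd G" "f \<in> sides e"
  shows "path_image (c e) \<subseteq> closure f"
proof -
  obtain t where t: "0 < t" "t < 1" "c e t \<in> closure f"
    using assms by (auto simp: sides_def edge_interior_eq)
  show ?thesis
    by (rule arc_subset_closure_component[OF closed_drawing[OF wf_sub_rest] arc_edge edge_meets_rest _ t])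
       (use assms drawing_split_edge in \<open>auto simp: sides_def faces_def\<close>)
qed

text \<open>Local two-sidedness of arcs with \<open>K\<close> taken as the drawing of all vertices
  and all other edges, restated for faces of \<open>G\<close>.\<close>

lemma edge_sides_locally:
  assumes e: "e \<in> snd G" and z: "z \<in> edge_interior e"
  obtains r P where "r > 0"
    "\<And>f f' p q. p \<in> ball z r \<Longrightarrow> q \<in> ball z r \<Longrightarrow> P p = (P q :: bool) \<Longrightarrow>
       f \<in> faces pos c G \<Longrightarrow> f' \<in> faces pos c G \<Longrightarrow> p \<in> f \<Longrightarrow> q \<in> f' \<Longrightarrow> f = f'"
proof -
  obtain t where t: "0 < t" "t < 1" "z = c e t"
    using assms by (auto simp: edge_interior_eq)
  obtain r P where r: "r > 0" and P:
    "\<And>p q. p \<in> ball z r - D G \<Longrightarrow> q \<in> ball z r - D G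
      \<Longrightarrow> P p = (P q :: bool) \<Longrightarrow> connected_component (- D G) p q"
    using arc_two_sided[OF closed_drawing[OF wf_sub_rest[OF e]] arc_edge[OF e] edge_meets_rest[OF e] t(1,2)]
    unfolding drawing_split_edge[OF e, symmetric] t(3) by metis
  show thesis
  proof (rule that[OF r])
    fix f f' p q
    assume a: "p \<in> ball z r" "q \<in> ball z r" "P p = P q" "f \<in> faces pos c G" "f' \<in> faces pos c G" "p \<in> f" "q \<in> f'"
    then have "connected_component (- D G) p q"
      using face_disjoint_drawing[of f G] face_disjoint_drawing[of f' G] by (intro P) auto
    then obtain t where t: "connected t" "t \<inter> D G = {}" "p \<in> t" "q \<in> t"
      unfolding connected_component_def by blast
    then have "t \<subseteq> f" using face_absorbs[of f G t] a by blast
    then show "f = f'" using faces_eq[of f G f'] a t by blast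
  qed
qed

text \<open>Every side has a point in the ball where faces are determined by a Boolean label, so the
  label of a chosen point injects the sides into \<open>bool\<close>.\<close>

lemma card_sides:
  assumes e: "e \<in> snd G"
  shows "finite (sides e) \<and> card (sides e) \<le> 2"
proof -
  obtain z where z: "z \<in> edge_interior e" using edge_interior_nonempty[OF e] by blast
  obtain r P where r: "r > 0" and P:
    "\<And>f f' p q. p \<in> ball z r \<Longrightarrow> q \<in> ball z r \<Longrightarrow> P p = (P q :: bool) \<Longrightarrow>
       f \<in> faces pos c G \<Longrightarrow> f' \<in> faces pos c G \<Longrightarrow> p \<in> f \<Longrightarrow> q \<in> f' \<Longrightarrow> f = f'"
    using edge_sides_locally[OF e z] by metis
  have "\<exists>p. p \<in> f \<and> p \<in> ball z r" if "f \<in> sides e" for f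
  proof -
    have "z \<in> closure f" using sides_closure[OF e that] z by (auto simp: edge_interior_def)
    then show ?thesis using r open_Int_closure_eq_empty[of "ball z r" f] centre_in_ball[of z r] by blast
  qed
  then obtain p where p: "\<And>f. f \<in> sides e \<Longrightarrow> p f \<in> f \<and> p f \<in> ball z r" by metis
  have "inj_on (\<lambda>f. P (p f)) (sides e)"
  proof (rule inj_onI)
    fix f f' assume "f \<in> sides e" "f' \<in> sides e" "P (p f) = P (p f')"
    then show "f = f'" using P[of "p f" "p f'" f f'] p by (simp add: sides_def)
  qed
  moreover have "(\<lambda>f. P (p f)) ` sides e \<subseteq> UNIV" "finite (UNIV :: bool set)" by auto
  ultimately show ?thesis
    by (metis (no_types) inj_on_finite card_inj_on_le card_UNIV_bool)
qed

text \<open>The off-drawing points with one label form part of a single face. Either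
  \<open>z\<close> adheres to them, and that face is a side, or a smaller ball avoids them
  altogether.\<close>

lemma near_edge_in_sides:
  assumes e: "e \<in> snd G" and z: "z \<in> edge_interior e"
  obtains r where "r > 0" "ball z r - D G \<subseteq> \<Union>(sides e)"
proof -
  obtain r P where r: "r > 0" and P:
    "\<And>f f' p q. p \<in> ball z r \<Longrightarrow> q \<in> ball z r \<Longrightarrow> P p = (P q :: bool) \<Longrightarrow>
       f \<in> faces pos c G \<Longrightarrow> f' \<in> faces pos c G \<Longrightarrow> p \<in> f \<Longrightarrow> q \<in> f' \<Longrightarrow> f = f'"
    using edge_sides_locally[OF e z] by metis
  have "\<exists>s>0. \<forall>p\<in>ball z s \<inter> ball z r - D G. P p = b \<longrightarrow> p \<in> \<Union>(sides e)" for b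
  proof (cases "z \<in> closure {p \<in> ball z r - D G. P p = b}")
    case True
    then obtain p0 where "p0 \<in> ball z r - D G" "P p0 = b"
      by (metis (mono_tags, lifting) closure_empty empty_iff ex_in_conv mem_Collect_eq)
    then obtain f0 where f0: "f0 \<in> faces pos c G" "p0 \<in> f0" using point_in_face[of p0 G] by blast
    have sub: "{p \<in> ball z r - D G. P p = b} \<subseteq> f0"
    proof clarify
      fix p assume "p \<in> ball z r" "p \<notin> D G" "b = P p"
      moreover obtain f where "f \<in> faces pos c G" "p \<in> f" using point_in_face[of p G] \<open>p \<notin> D G\<close> by blast
      ultimately show "p \<in> f0"
        using P[of p p0 f f0] f0 \<open>p0 \<in> ball z r - D G\<close> \<open>P p0 = b\<close> by auto
    qed
    then have "z \<in> closure f0" using True closure_mono by blast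
    then have "f0 \<in> sides e" using f0 z by (auto simp: sides_def)
    then show ?thesis using sub r by (intro exI[of _ r]) blast
  next
    case False
    define Q where "Q = {p \<in> ball z r - D G. P p = b}"
    have "z \<in> - closure Q" "open (- closure Q)" using False by (auto simp: Q_def)
    then obtain s where s: "s > 0" "ball z s \<subseteq> - closure Q" using openE by metis
    then have "ball z s \<inter> Q = {}" using closure_subset[of Q] by blast
    then show ?thesis using s(1) unfolding Q_def by (intro exI[of _ s]) blast
  qed
  then obtain s where s: "\<And>b. s b > 0" "\<And>b p. p \<in> ball z (s b) \<inter> ball z r - D G \<Longrightarrow> P p = b \<Longrightarrow> p \<in> \<Union>(sides e)"
    by metis
  show thesis
  proof (rule that[of "min r (min (s True) (s False))"])
    show "0 < min r (min (s True) (s False))" using r s by simp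
    show "ball z (min r (min (s True) (s False))) - D G \<subseteq> \<Union> (sides e)"
    proof
      fix p assume "p \<in> ball z (min r (min (s True) (s False))) - D G"
      then show "p \<in> \<Union>(sides e)" using s(2)[of p "P p"] by (cases "P p") auto
    qed
  qed
qed

text \<open>The drawing has empty interior, so \<open>W\<close> has points off the drawing
  arbitrarily close to the edge, and there only sides of \<open>e\<close> occur.\<close>

lemma side_meeting_open:
  assumes e: "e \<in> snd G" and W: "open W" "edge_interior e \<inter> closure W \<noteq> {}"
  shows "\<exists>f\<in>sides e. f \<inter> W \<noteq> {}"
proof -
  obtain z where z: "z \<in> edge_interior e" "z \<in> closure W" using W by blast
  obtain r where r: "r > 0" "ball z r - D G \<subseteq> \<Union>(sides e)" using near_edge_in_sides[OF e z(1)] .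
  have "ball z r \<inter> W \<noteq> {}"
    using z(2) r(1) open_Int_closure_eq_empty[of "ball z r" W] centre_in_ball[of z r] by blast
  then have "\<not> (ball z r \<inter> W \<subseteq> D G)"
    using interior_drawing[OF wf_sub_G] interior_maximal[of "ball z r \<inter> W" "D G"] W by auto
  then show ?thesis using r by blast
qed

text \<open>\<open>f1 = f2\<close> is allowed and is the case of a bridge. This form turns claims
  about perimeters into Boolean checks on two faces.\<close>

lemma sides_pair:
  assumes e: "e \<in> snd G"
  obtains f1 f2 where "sides e = {f1, f2}"
proof -
  have "sides e \<noteq> {}"
    using side_meeting_open[OF e, of UNIV] edge_interior_nonempty[OF e] by auto
  then have "card (sides e) = 1 \<or> card (sides e) = 2"
    using card_sides[OF e] by (metis card_0_eq le_less less_2_cases One_nat_def)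
  then show thesis using that by (metis card_1_singletonE card_2_iff insert_absorb2)
qed

lemma sides_face: "f \<in> sides e \<Longrightarrow> f \<in> faces pos c G"
  by (simp add: sides_def)

lemma bnd_subset: "bnd B \<subseteq> snd G"
  by (auto simp: bnd_def)

lemma finite_bnd: "finite (bnd B)"
  using bnd_subset finite_edges finite_subset by blast

text \<open>Additivity modulo 2. It depends on an edge having at most two sides: with three,
  toggling faces could leave the edge on the perimeter of all three sets.\<close>

lemma bnd_sym_diff: "bnd (A - B \<union> (B - A)) = bnd A - bnd B \<union> (bnd B - bnd A)"
proof -
  have "e \<in> bnd (A - B \<union> (B - A)) \<longleftrightarrow> e \<in> bnd A - bnd B \<union> (bnd B - bnd A)" if e: "e \<in> snd G" for e
  proof -
    obtain f1 f2 where "sides e = {f1, f2}" using sides_pair[OF e] .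
    then show ?thesis using e by (auto simp: bnd_def)
  qed
  then show ?thesis using bnd_subset by blast
qed

lemma bnd_submodular:
  fixes w :: "'v set \<Rightarrow> real"
  assumes "\<forall>e\<in>snd G. w e > 0"
  shows "sum w (bnd (A \<union> B)) + sum w (bnd (A \<inter> B)) \<le> sum w (bnd A) + sum w (bnd B)"
proof -
  have *: "sum w (bnd S) = (\<Sum>e\<in>snd G. if e \<in> bnd S then w e else 0)" for S
    using bnd_subset[of S] finite_edges by (simp add: sum.If_cases inf.absorb2)
  have "(if e \<in> bnd (A \<union> B) then w e else 0) + (if e \<in> bnd (A \<inter> B) then w e else 0)
     \<le> (if e \<in> bnd A then w e else 0) + (if e \<in> bnd B then w e else 0)" if e: "e \<in> snd G" for e
  proof -
    obtain f1 f2 where "sides e = {f1, f2}" using sides_pair[OF e] .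
    then show ?thesis using e assms by (auto simp: bnd_def less_imp_le)
  qed
  then show ?thesis unfolding * sum.distrib[symmetric] by (rule sum_mono)
qed

section \<open>Faces of a subgraph seen as unions of faces of \<open>G\<close>\<close>

lemma face_subset_or_disjoint:
  assumes "wf_sub H" "F \<in> faces pos c H" "f \<in> faces pos c G"
  shows "f \<subseteq> F \<or> f \<inter> F = {}"
  using face_absorbs[of F H f] assms face_connected[of f G] face_disjoint_drawing[of f G] drawing_subset_G[of H]
  by blast

text \<open>An edge outside \<open>H\<close> has an interior point in an open face of
  \<open>H\<close>, which swallows every side of the edge; so the edge cannot separate
  \<open>F\<close> from its complement.\<close>

lemma bnd_faces_in:
  assumes H: "wf_sub H" "F \<in> faces pos c H" and e: "e \<in> bnd (faces_in F)"
  shows "e \<in> snd H" "path_image (c e) \<subseteq> frontier F"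
proof -
  have eG: "e \<in> snd G" using e bnd_subset by blast
  obtain f g where fg: "f \<in> sides e" "f \<subseteq> F" "g \<in> sides e" "\<not> g \<subseteq> F"
    using e sides_face by (auto simp: bnd_def faces_in_def)
  show eH: "e \<in> snd H"
  proof (rule ccontr)
    assume eH: "e \<notin> snd H"
    obtain z where z: "z \<in> edge_interior e" using edge_interior_nonempty[OF eG] by blast
    have "z \<notin> D H" using edge_interior_drawing[OF eG H(1) eH] z by blast
    then obtain F' where F': "F' \<in> faces pos c H" "z \<in> F'" using point_in_face by blast
    have "h \<subseteq> F'" if "h \<in> sides e" for h
    proof -
      have "z \<in> closure h" using sides_closure[OF eG that] z by (auto simp: edge_interior_def)
      then have "F' \<inter> h \<noteq> {}" using open_face[OF H(1) F'(1)] F'(2) open_Int_closure_eq_empty[of F' h] by blast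
      then show ?thesis using face_subset_or_disjoint[OF H(1) F'(1) sides_face[OF that]] by blast
    qed
    then have "F = F'" "g \<subseteq> F'" using fg faces_eq[OF H(2) F'(1)] face_nonempty[OF sides_face[OF fg(1)]] by blast+
    then show False using fg by blast
  qed
  have "path_image (c e) \<subseteq> closure F" using sides_closure[OF eG fg(1)] closure_mono[OF fg(2)] by blast
  moreover have "path_image (c e) \<subseteq> D H" using eH by (auto simp: drawing_def)
  ultimately show "path_image (c e) \<subseteq> frontier F"
    using face_disjoint_drawing[OF H(2)] interior_subset[of F] by (auto simp: frontier_def)
qed

lemma side_within_face:
  assumes H: "wf_sub H" "F \<in> faces pos c H" and e: "e \<in> snd G" "edge_interior e \<inter> frontier F \<noteq> {}"
  shows "\<exists>f\<in>sides e. f \<in> faces_in F"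
proof -
  have "edge_interior e \<inter> closure F \<noteq> {}" using e(2) by (auto simp: frontier_def)
  then obtain f where "f \<in> sides e" "f \<inter> F \<noteq> {}"
    using side_meeting_open[OF e(1) open_face[OF H]] by blast
  then show ?thesis using face_subset_or_disjoint[OF H] sides_face unfolding faces_in_def by blast
qed

lemma wf_sub_face_boundary:
  assumes H: "wf_sub H"
  shows "wf_sub (face_boundary pos c H F)"
proof -
  have "pos u \<in> frontier F" if "e \<in> snd H" "path_image (c e) \<subseteq> frontier F" "u \<in> e" for e u
    using that path_image_edge[of e] H by (auto simp: wf_sub_def)
  then show ?thesis using H unfolding wf_sub_def face_boundary_def by auto
qed

text \<open>A frontier point inside an edge gives a side of that edge within \<open>F\<close>, and a
  side adheres to the whole edge; so no edge lies only partly on the frontier.\<close>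

lemma frontier_face_eq:
  assumes H: "wf_sub H" "F \<in> faces pos c H"
  shows "D (face_boundary pos c H F) = frontier F"
proof
  show "D (face_boundary pos c H F) \<subseteq> frontier F"
    by (auto simp: drawing_def face_boundary_def)
  show "frontier F \<subseteq> D (face_boundary pos c H F)"
  proof
    fix x assume x: "x \<in> frontier F"
    then have "x \<in> D H" using frontier_face[OF H] by blast
    then consider v where "v \<in> fst H" "x = pos v" | e where "e \<in> snd H" "x \<in> edge_interior e"
      using drawing_eq[OF H(1)] by blast
    then show "x \<in> D (face_boundary pos c H F)"
    proof cases
      case 1
      then show ?thesis using x by (auto simp: drawing_def face_boundary_def)
    next
      case 2
      have eG: "e \<in> snd G" using 2 H by (auto simp: wf_sub_def)
      obtain f where f: "f \<in> sides e" "f \<subseteq> F"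
        using side_within_face[OF H eG] 2 x by (auto simp: faces_in_def)
      then have "path_image (c e) \<subseteq> closure F" using sides_closure[OF eG f(1)] closure_mono[OF f(2)] by blast
      moreover have "path_image (c e) \<subseteq> D H" using 2 by (auto simp: drawing_def)
      ultimately have "path_image (c e) \<subseteq> frontier F"
        using face_disjoint_drawing[OF H(2)] interior_subset[of F] by (auto simp: frontier_def)
      then show ?thesis using 2 by (auto simp: drawing_def face_boundary_def edge_interior_def)
    qed
  qed
qed

lemma face_eq_component: "F \<in> faces pos c H \<Longrightarrow> x \<in> F \<Longrightarrow> F = connected_component_set (- D H) x"
  unfolding faces_def components_iff using connected_component_eq by fastforce

lemma outer_face_eq_outside: "outer_face pos c H = outside (D H)"
proof (rule set_eqI)
  fix x
  show "x \<in> outer_face pos c H \<longleftrightarrow> x \<in> outside (D H)"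
  proof (cases "x \<in> D H")
    case True
    then show ?thesis
      using face_disjoint_drawing[of _ H] outside_no_overlap[of "D H"] unfolding outer_face_def by blast
  next
    case False
    then obtain F where F: "F \<in> faces pos c H" "x \<in> F" using point_in_face by blast
    then have "x \<in> outer_face pos c H \<longleftrightarrow> \<not> bounded F"
      unfolding outer_face_def using faces_eq by blast
    then show ?thesis using face_eq_component[OF F] by (simp add: outside)
  qed
qed

lemma outside_in_faces:
  assumes "wf_sub H"
  shows "outside (D H) \<in> faces pos c H"
proof -
  have b: "bounded (D H)" using compact_drawing[OF assms] compact_imp_bounded by blast
  show ?thesis
    unfolding faces_def using b
    by (metis DIM_complex connected_outside order_refl outside_in_components outside_bounded_nonempty)
qed

lemma unbounded_outside_drawing: "wf_sub H \<Longrightarrow> \<not> bounded (outside (D H))"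
  using compact_drawing compact_imp_bounded unbounded_outside by blast

lemma unbounded_face:
  assumes H: "wf_sub H" "F \<in> faces pos c H" "\<not> bounded F"
  shows "F = outside (D H)"
proof -
  have "F \<subseteq> outside (D H)"
    using face_eq_component[OF H(2)] H(3) unfolding outside by fastforce
  then show ?thesis
    using faces_eq[OF H(2) outside_in_faces[OF H(1)]] face_nonempty[OF H(2)] by blast
qed

end

section \<open>Walks, cycles and vertex cuts\<close>

lemma walk_edges_Nil [simp]: "walk_edges [] = {}"
  and walk_edges_single [simp]: "walk_edges [x] = {}"
  by (auto simp: walk_edges_def)

lemma walk_edges_Cons [simp]: "walk_edges (x # y # zs) = insert {x, y} (walk_edges (y # zs))"
proof -
  have "walk_edges (x # y # zs) = (\<lambda>i. {(x # y # zs) ! i, (x # y # zs) ! Suc i}) ` {i. Suc i < length (x # y # zs)}"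
    unfolding walk_edges_def by auto
  also have "{i. Suc i < length (x # y # zs)} = insert 0 (Suc ` {i. Suc i < length (y # zs)})"
    by (auto simp: image_iff) (metis not0_implies_Suc Suc_less_eq)
  finally show ?thesis
    unfolding walk_edges_def by (auto simp: image_iff)
qed

lemma finite_walk_edges [simp]: "finite (walk_edges xs)"
  by (induction xs rule: induct_list012) auto

lemma walk_edges_subset: "e \<in> walk_edges xs \<Longrightarrow> e \<subseteq> set xs"
  by (induction xs rule: induct_list012) auto

lemma walk_edges_append: "walk_edges (xs @ v # ys) = walk_edges (xs @ [v]) \<union> walk_edges (v # ys)"
proof (induction xs)
  case (Cons x xs)
  then show ?case by (cases xs) auto
qed simp

lemma weight_single [simp]: "weight w [x] = 0"
  by (simp add: weight_def)

lemma weight_Cons [simp]: "weight w (x # y # zs) = w {x, y} + weight w (y # zs)"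
  unfolding weight_def by (simp add: sum.lessThan_Suc_shift del: sum.lessThan_Suc)

lemma weight_append: "weight w (xs @ v # ys) = weight w (xs @ [v]) + weight w (v # ys)"
proof (induction xs)
  case (Cons x xs)
  then show ?case by (cases xs) auto
qed simp

lemma weight_distinct: "distinct xs \<Longrightarrow> weight w xs = sum w (walk_edges xs)"
proof (induction xs rule: induct_list012)
  case (3 x y zs)
  then have "{x, y} \<notin> walk_edges (y # zs)" using walk_edges_subset[of "{x, y}" "y # zs"] by auto
  then show ?case using 3 by simp
qed (auto simp: weight_def)

section \<open>Reachability by edges, parity of cuts, forests\<close>

definition conn :: "'v set set \<Rightarrow> 'v \<Rightarrow> 'v \<Rightarrow> bool" where
  "conn D x y \<longleftrightarrow> (x, y) \<in> {(a, b). {a, b} \<in> D}\<^sup>*"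

lemma conn_refl [simp]: "conn D x x"
  by (simp add: conn_def)

lemma conn_step: "conn D x y \<Longrightarrow> {y, z} \<in> D \<Longrightarrow> conn D x z"
  unfolding conn_def by (meson CollectI case_prodI rtrancl.rtrancl_into_rtrancl)

lemma conn_trans: "conn D x y \<Longrightarrow> conn D y z \<Longrightarrow> conn D x z"
  unfolding conn_def by simp

lemma conn_sym: "conn D x y \<Longrightarrow> conn D y x"
proof -
  have "sym {(a, b). {a, b} \<in> D}" by (auto simp: sym_def insert_commute)
  then show "conn D x y \<Longrightarrow> conn D y x" unfolding conn_def by (meson sym_rtrancl symD)
qed

lemma conn_mono: "D \<subseteq> D' \<Longrightarrow> conn D x y \<Longrightarrow> conn D' x y"
  unfolding conn_def by (erule rtrancl_mono[THEN subsetD, rotated]) auto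

lemma set_eq_Union_walk_edges: "2 \<le> length xs \<Longrightarrow> set xs = \<Union>(walk_edges xs)"
proof (induction xs rule: induct_list012)
  case (3 x y zs)
  then show ?case by (cases zs) auto
qed auto

lemma walk_edges_split: "e \<in> walk_edges xs \<Longrightarrow> \<exists>as a b bs. e = {a, b} \<and> xs = as @ a # b # bs"
proof (induction xs rule: induct_list012)
  case (3 x y zs)
  then consider "e = {x, y}" | "e \<in> walk_edges (y # zs)" by auto
  then show ?case
  proof cases
    case 1
    then show ?thesis by (metis append_Nil)
  next
    case 2
    then obtain as a b bs where "e = {a, b}" "y # zs = as @ a # b # bs" using 3 by blast
    then show ?thesis by (metis append_Cons)
  qed
qed auto

lemma conn_walk: "xs \<noteq> [] \<Longrightarrow> walk_edges xs \<subseteq> D \<Longrightarrow> x \<in> set xs \<Longrightarrow> conn D (hd xs) x"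
proof (induction xs rule: induct_list012)
  case (3 a b zs)
  have "conn D a b" using 3 conn_step[OF conn_refl] by auto
  then show ?case using 3 conn_trans by auto
qed auto

lemma conn_distinct_walk:
  assumes "conn D x y"
  obtains xs where "xs \<noteq> []" "distinct xs" "hd xs = x" "last xs = y" "walk_edges xs \<subseteq> D"
proof -
  have "\<exists>xs. xs \<noteq> [] \<and> distinct xs \<and> hd xs = x \<and> last xs = y \<and> walk_edges xs \<subseteq> D"
    using assms unfolding conn_def
  proof (induction rule: rtrancl_induct)
    case base
    show ?case by (rule exI[of _ "[x]"]) auto
  next
    case (step y z)
    then obtain xs where xs: "xs \<noteq> []" "distinct xs" "hd xs = x" "last xs = y" "walk_edges xs \<subseteq> D" by blast
    show ?case
    proof (cases "z \<in> set xs")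
      case True
      then obtain as bs where ab: "xs = as @ z # bs" by (meson split_list)
      then have "walk_edges (as @ [z]) \<subseteq> D" using xs(5) walk_edges_append[of as z bs] by auto
      then show ?thesis using xs ab by (intro exI[of _ "as @ [z]"]) (cases as; auto)
    next
      case False
      obtain as where as: "xs = as @ [y]" using xs by (metis append_butlast_last_id)
      have "walk_edges (as @ y # [z]) \<subseteq> D" using walk_edges_append[of as y "[z]"] xs step as by auto
      then show ?thesis using xs False as by (intro exI[of _ "xs @ [z]"]) (cases as; auto)
    qed
  qed
  then show thesis using that by blast
qed

definition cut_edges :: "'v set \<Rightarrow> 'v set set \<Rightarrow> 'v set set" where
  "cut_edges S D = {e \<in> D. e \<inter> S \<noteq> {} \<and> \<not> e \<subseteq> S}"

text \<open>Membership in the cycle space, expressed as orthogonality to all cuts rather than as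
  even degrees: the later argument uses the cut around a component, not single vertices.\<close>

definition even_cuts :: "'v set set \<Rightarrow> bool" where
  "even_cuts D \<longleftrightarrow> (\<forall>S. even (card (cut_edges S D)))"

lemma even_card_sym_diff:
  assumes "finite A" "finite B"
  shows "even (card (A - B \<union> (B - A))) \<longleftrightarrow> (even (card A) \<longleftrightarrow> even (card B))"
proof -
  have "card (A - B \<union> (B - A)) = card (A - B) + card (B - A)"
    using assms by (intro card_Un_disjoint) auto
  moreover have "card A = card (A - B) + card (A \<inter> B)" "card B = card (B - A) + card (A \<inter> B)"
    using assms card_Int_Diff[of A B] card_Int_Diff[of B A] by (auto simp: Int_commute)
  ultimately show ?thesis by (metis even_add)
qed

lemma even_cut_sym_diff:
  assumes "finite A" "finite B"
  shows "even (card (cut_edges S (A - B \<union> (B - A)))) \<longleftrightarrow>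
    (even (card (cut_edges S A)) \<longleftrightarrow> even (card (cut_edges S B)))"
proof -
  have "cut_edges S (A - B \<union> (B - A)) = cut_edges S A - cut_edges S B \<union> (cut_edges S B - cut_edges S A)"
    by (auto simp: cut_edges_def)
  moreover have "finite (cut_edges S A)" "finite (cut_edges S B)"
    using assms by (auto simp: cut_edges_def)
  ultimately show ?thesis using even_card_sym_diff by simp
qed

text \<open>Each crossing edge switches the side of the cut, and a distinct walk uses no edge
  twice.\<close>

lemma cut_edges_path:
  "distinct xs \<Longrightarrow> xs \<noteq> [] \<Longrightarrow> odd (card (cut_edges S (walk_edges xs))) \<longleftrightarrow> (hd xs \<in> S) \<noteq> (last xs \<in> S)"
proof (induction xs rule: induct_list012)
  case (3 x y zs)
  have n: "{x, y} \<notin> walk_edges (y # zs)" using 3 walk_edges_subset[of "{x, y}" "y # zs"] by auto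
  have fin: "finite (cut_edges S (walk_edges (y # zs)))" by (simp add: cut_edges_def)
  show ?case
  proof (cases "(x \<in> S) = (y \<in> S)")
    case True
    then have "cut_edges S (walk_edges (x # y # zs)) = cut_edges S (walk_edges (y # zs))"
      by (auto simp: cut_edges_def)
    then show ?thesis using 3 True by simp
  next
    case False
    then have "cut_edges S (walk_edges (x # y # zs)) = insert {x, y} (cut_edges S (walk_edges (y # zs)))"
      by (auto simp: cut_edges_def)
    moreover have "{x, y} \<notin> cut_edges S (walk_edges (y # zs))" using n by (simp add: cut_edges_def)
    ultimately show ?thesis using 3 False fin by simp
  qed
qed (auto simp: cut_edges_def)

text \<open>Every edge is a bridge. In this form a failure directly supplies an edge and a detour
  around it, hence a cycle.\<close>

definition forest :: "'v set set \<Rightarrow> bool" where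
  "forest D \<longleftrightarrow> (\<forall>u v. {u, v} \<in> D \<longrightarrow> \<not> conn (D - {{u, v}}) u v)"

lemma forest_subset: "forest D \<Longrightarrow> D' \<subseteq> D \<Longrightarrow> forest D'"
  unfolding forest_def using conn_mono[of "D' - _" "D - _"] by (metis Diff_mono order_refl subsetD)

section \<open>Paths and cycles of \<open>G\<close> as arcs and Jordan curves\<close>

context plane
begin

lemma conn_path:
  assumes "conn A x y" "A \<subseteq> snd G" "x \<in> fst G"
  obtains q where "walk G q" "distinct q" "hd q = x" "last q = y" "walk_edges q \<subseteq> A"
proof -
  obtain q where q: "q \<noteq> []" "distinct q" "hd q = x" "last q = y" "walk_edges q \<subseteq> A"
    using conn_distinct_walk[OF assms(1)] .
  have "set q \<subseteq> fst G"
  proof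
    fix z assume z: "z \<in> set q"
    have "conn (snd G) x z" using conn_walk[of q "snd G" z] q z assms(2) by blast
    then show "z \<in> fst G" unfolding conn_def
      by (induction rule: rtrancl_induct) (use assms(3) edge_subset in auto)
  qed
  then show thesis using that q assms(2) by (auto simp: walk_def)
qed

lemma wf_sub_path_graph: "walk G xs \<Longrightarrow> wf_sub (path_graph xs)"
  using walk_edges_subset by (fastforce simp: walk_def wf_sub_def path_graph_def)

lemma wf_sub_union: "wf_sub H \<Longrightarrow> wf_sub K \<Longrightarrow> wf_sub (graph_union H K)"
  by (auto simp: wf_sub_def graph_union_def)

lemma drawing_union: "D (graph_union H K) = D H \<union> D K"
  by (auto simp: drawing_def graph_union_def)

lemma drawing_edge: "e \<in> snd G \<Longrightarrow> D (e, {e}) = path_image (c e)"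
  using path_image_edge by (auto simp: drawing_def)

lemma walk_edge: "walk G xs \<Longrightarrow> e \<in> walk_edges xs \<Longrightarrow> e \<in> snd G"
  by (auto simp: walk_def)

text \<open>Edges are joined one by one; each meets the remaining piece only in the common vertex.
  Distinct ends exclude the one-vertex walk, whose drawing is a point and no arc.\<close>

lemma walk_arc:
  assumes "walk G xs" "distinct xs" "hd xs \<noteq> last xs"
  shows "\<exists>g. arc g \<and> pathstart g = pos (hd xs) \<and> pathfinish g = pos (last xs) \<and> path_image g = D (path_graph xs)"
  using assms
proof (induction xs rule: induct_list012)
  case (3 x y zs)
  have e: "{x, y} \<in> snd G" using 3 by (simp add: walk_def)
  have xy: "x \<noteq> y" "x \<in> fst G" "y \<in> fst G" using 3 by (auto simp: walk_def)
  have "{pathstart (c {x, y}), pathfinish (c {x, y})} = {pos x, pos y}" using edge_ends[OF e] by simp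
  then consider "pathstart (c {x, y}) = pos x" "pathfinish (c {x, y}) = pos y"
    | "pathstart (c {x, y}) = pos y" "pathfinish (c {x, y}) = pos x"
    by (auto simp: doubleton_eq_iff)
  then obtain g1 where g1: "arc g1" "pathstart g1 = pos x" "pathfinish g1 = pos y" "path_image g1 = path_image (c {x, y})"
  proof cases
    case 1
    then show ?thesis using that[of "c {x, y}"] arc_edge[OF e] by simp
  next
    case 2
    then show ?thesis using that[of "reversepath (c {x, y})"] arc_edge[OF e] by (simp add: arc_reversepath)
  qed
  have D1: "D (path_graph (x # y # zs)) = path_image (c {x, y}) \<union> D (path_graph (y # zs))"
    using path_image_edge[OF e] by (auto simp: drawing_def path_graph_def)
  show ?case
  proof (cases zs)
    case Nil
    have "D (path_graph (x # y # zs)) = path_image (c {x, y})"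
      using path_image_edge[OF e] Nil by (auto simp: drawing_def path_graph_def)
    then show ?thesis using g1 Nil by auto
  next
    case (Cons z zs')
    have w: "walk G (y # zs)" using 3 by (auto simp: walk_def)
    have "hd (y # zs) \<noteq> last (y # zs)" using 3(4) Cons by auto
    then obtain g2 where g2: "arc g2" "pathstart g2 = pos y" "pathfinish g2 = pos (last (y # zs))"
       "path_image g2 = D (path_graph (y # zs))"
      using 3 w by auto
    have "path_image g1 \<inter> path_image g2 = D ({x, y}, {{x, y}}) \<inter> D (path_graph (y # zs))"
      using g1 g2 drawing_edge[OF e] by simp
    also have "\<dots> = pos ` ({x, y} \<inter> set (y # zs))"
    proof -
      have "wf_sub ({x, y}, {{x, y}})" using e xy by (auto simp: wf_sub_def)
      moreover have "{x, y} \<notin> walk_edges (y # zs)" using 3 walk_edges_subset[of "{x, y}" "y # zs"] by auto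
      ultimately show ?thesis
        using drawing_inter[OF _ wf_sub_path_graph[OF w], of "({x, y}, {{x, y}})"] by (auto simp: path_graph_def)
    qed
    also have "\<dots> = {pos y}" using 3 by auto
    finally have "arc (g1 +++ g2)" using g1 g2 by (intro arc_join) auto
    moreover have "path_image (g1 +++ g2) = D (path_graph (x # y # zs))"
      using g1 g2 D1 by (simp add: path_image_join)
    ultimately show ?thesis using g1 g2 by (intro exI[of _ "g1 +++ g2"]) auto
  qed
qed (auto simp: walk_def)

text \<open>Beyond internal disjointness, edge-disjointness only rules out that both paths are the
  single edge between \<open>u\<close> and \<open>v\<close>, where no curve would close up.\<close>

lemma cycle_Jordan:
  assumes P: "walk G P" "distinct P" "hd P = u" "last P = v"
    and Q: "walk G Q" "distinct Q" "hd Q = u" "last Q = v"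
    and uv: "u \<noteq> v" "set P \<inter> set Q = {u, v}" "walk_edges P \<inter> walk_edges Q = {}"
  defines "J \<equiv> D (graph_union (path_graph P) (path_graph Q))"
  shows "inside J \<in> faces pos c (graph_union (path_graph P) (path_graph Q))"
    and "outside J \<in> faces pos c (graph_union (path_graph P) (path_graph Q))"
    and "frontier (inside J) = J" "frontier (outside J) = J" "bounded (inside J)"
    and "bnd (faces_in (inside J)) = walk_edges P \<union> walk_edges Q"
proof -
  let ?H = "graph_union (path_graph P) (path_graph Q)"
  obtain g where g: "arc g" "pathstart g = pos u" "pathfinish g = pos v" "path_image g = D (path_graph P)"
    using walk_arc[of P] P uv by auto
  obtain h where h: "arc h" "pathstart h = pos u" "pathfinish h = pos v" "path_image h = D (path_graph Q)"
    using walk_arc[of Q] Q uv by auto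
  have "path_image g \<inter> path_image h = pos ` (set P \<inter> set Q)"
    using drawing_inter[OF wf_sub_path_graph[OF P(1)] wf_sub_path_graph[OF Q(1)]] g h uv by (simp add: path_graph_def)
  then have sp: "simple_path (g +++ reversepath h)"
    using g h uv by (intro simple_path_join_loop) (auto simp: arc_reversepath)
  have im: "path_image (g +++ reversepath h) = J"
    using g h by (simp add: path_image_join J_def drawing_union)
  note Jordan = Jordan_inside_outside[OF sp, unfolded im]
  have lp: "pathfinish (g +++ reversepath h) = pathstart (g +++ reversepath h)" using g h by simp
  have wf: "wf_sub ?H" using P Q by (simp add: wf_sub_union wf_sub_path_graph)
  show i: "inside J \<in> faces pos c ?H" and o: "outside J \<in> faces pos c ?H"
    using Jordan lp inside_in_components[of J] outside_in_components[of J] unfolding faces_def J_def by auto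
  show fi: "frontier (inside J) = J" and fo: "frontier (outside J) = J" and "bounded (inside J)"
    using Jordan lp by auto
  have sH: "snd ?H = walk_edges P \<union> walk_edges Q" by (simp add: graph_union_def path_graph_def)
  show "bnd (faces_in (inside J)) = walk_edges P \<union> walk_edges Q"
  proof
    show "bnd (faces_in (inside J)) \<subseteq> walk_edges P \<union> walk_edges Q"
      using bnd_faces_in(1)[OF wf i] sH by blast
    \<comment> \<open>An edge of a Jordan curve lies on the frontier of both complementary domains,
      so it has a side in each.\<close>
    show "walk_edges P \<union> walk_edges Q \<subseteq> bnd (faces_in (inside J))"
    proof
      fix e assume e: "e \<in> walk_edges P \<union> walk_edges Q"
      then have eG: "e \<in> snd G" using walk_edge P Q by blast
      have "path_image (c e) \<subseteq> J" using e sH unfolding J_def drawing_def by auto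
      then have "edge_interior e \<inter> J \<noteq> {}" using edge_interior_nonempty[OF eG] by (auto simp: edge_interior_def)
      then obtain f f' where f: "f \<in> sides e" "f \<in> faces_in (inside J)" "f' \<in> sides e" "f' \<in> faces_in (outside J)"
        using side_within_face[OF wf i eG] side_within_face[OF wf o eG] fi fo by auto
      have "f' \<notin> faces_in (inside J)"
        using f(4) face_nonempty[OF sides_face[OF f(3)]] inside_Int_outside[of J] unfolding faces_in_def by blast
      then show "e \<in> bnd (faces_in (inside J))" using f eG by (auto simp: bnd_def)
    qed
  qed
qed

lemma even_cuts_cycle:
  assumes "distinct P" "P \<noteq> []" "distinct Q" "Q \<noteq> []" "hd P = hd Q" "last P = last Q" "walk_edges P \<inter> walk_edges Q = {}"
  shows "even_cuts (walk_edges P \<union> walk_edges Q)"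
  unfolding even_cuts_def
proof
  fix S
  have "walk_edges P \<union> walk_edges Q = walk_edges P - walk_edges Q \<union> (walk_edges Q - walk_edges P)"
    using assms by blast
  then have "even (card (cut_edges S (walk_edges P \<union> walk_edges Q))) \<longleftrightarrow>
     (even (card (cut_edges S (walk_edges P))) \<longleftrightarrow> even (card (cut_edges S (walk_edges Q))))"
    by (simp only: even_cut_sym_diff finite_walk_edges)
  then show "even (card (cut_edges S (walk_edges P \<union> walk_edges Q)))"
    using cut_edges_path[of P S] cut_edges_path[of Q S] assms by metis
qed

text \<open>The detour around the edge is one path and the edge itself, as \<open>[u, v]\<close>,
  the other.\<close>

lemma cycle_through_edge:
  assumes "A \<subseteq> snd G" "{u, v} \<in> A" "conn (A - {{u, v}}) u v"
  obtains H where "wf_sub H" "fst H = \<Union>(snd H)" "snd H \<subseteq> A" "{u, v} \<in> snd H" "even_cuts (snd H)"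
    "inside (D H) \<in> faces pos c H" "bnd (faces_in (inside (D H))) = snd H"
proof -
  have eG: "{u, v} \<in> snd G" using assms by blast
  have une: "u \<noteq> v" using edgeE[OF eG] by (metis insert_absorb2 doubleton_eq_iff)
  have uvG: "u \<in> fst G" "v \<in> fst G" using edge_subset[OF eG] by auto
  have "A - {{u, v}} \<subseteq> snd G" using assms(1) by blast
  then obtain P where P: "walk G P" "distinct P" "hd P = u" "last P = v" "walk_edges P \<subseteq> A - {{u, v}}"
    using conn_path[OF assms(3) _ uvG(1)] by blast
  have Pne: "P \<noteq> []" using P by (auto simp: walk_def)
  have wQ: "walk G [u, v]" using eG uvG by (auto simp: walk_def)
  have int: "set P \<inter> set [u, v] = {u, v}" using P Pne hd_in_set[of P] last_in_set[of P] by auto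
  have ed: "walk_edges P \<inter> walk_edges [u, v] = {}" using P by auto
  define H where "H = graph_union (path_graph P) (path_graph [u, v])"
  have sH: "snd H = walk_edges P \<union> walk_edges [u, v]" by (simp add: H_def graph_union_def path_graph_def)
  have "2 \<le> length P" using Pne une P by (cases P; cases "tl P") auto
  moreover have "fst H = set P \<union> {u, v}" by (simp add: H_def graph_union_def path_graph_def)
  ultimately have fH: "fst H = \<Union>(snd H)" using set_eq_Union_walk_edges[of P] sH by simp
  note J = cycle_Jordan[OF P(1-4) wQ _ _ _ une int ed]
  show thesis
  proof (rule that[of H])
    show "wf_sub H" unfolding H_def using P wQ wf_sub_union wf_sub_path_graph by blast
    show "even_cuts (snd H)" unfolding sH using P Pne une ed by (intro even_cuts_cycle) auto
    show "inside (D H) \<in> faces pos c H" "bnd (faces_in (inside (D H))) = snd H"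
      using J(1,6) une unfolding sH by (auto simp: H_def)
  qed (use fH sH P assms in auto)
qed

section \<open>Forests do not separate the plane, and perimeters meet cuts evenly\<close>

lemma
  assumes "wf_sub H" "S \<subseteq> fst H" "\<And>d. d \<in> snd H \<Longrightarrow> d \<subseteq> S \<or> d \<inter> S = {}"
  defines "T1 \<equiv> (S, {d \<in> snd H. d \<subseteq> S})" and "T2 \<equiv> (fst H - S, {d \<in> snd H. d \<inter> S = {}})"
  shows wf_sub_split: "wf_sub T1" "wf_sub T2"
    and edges_split: "snd T1 \<inter> snd T2 = {}"
    and drawing_split: "D H = D T1 \<union> D T2"
proof -
  show "wf_sub T1" "wf_sub T2"
    using assms(1-3) by (auto simp: wf_sub_def T1_def T2_def)
  have "d \<noteq> {}" if "d \<in> snd H" for d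
    using edgeE[OF wf_sub_edge[OF assms(1) that]] by (metis insert_not_empty)
  then show "snd T1 \<inter> snd T2 = {}" by (auto simp: T1_def T2_def)
  have "snd H = snd T1 \<union> snd T2" using assms(3) by (auto simp: T1_def T2_def)
  moreover have "fst H = fst T1 \<union> fst T2" using assms(2) by (auto simp: T1_def T2_def)
  ultimately show "D H = D T1 \<union> D T2" unfolding drawing_def by auto
qed

lemma conn_edge_closed:
  assumes "wf_sub H" "d \<in> snd H"
  shows "d \<subseteq> {x \<in> fst H. conn (snd H) u x} \<or> d \<inter> {x \<in> fst H. conn (snd H) u x} = {}"
proof -
  obtain a b where ab: "d = {a, b}" using edgeE[OF wf_sub_edge[OF assms]] by metis
  have "a \<in> fst H" "b \<in> fst H" using assms ab by (auto simp: wf_sub_def)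
  moreover have "conn (snd H) u a \<longleftrightarrow> conn (snd H) u b"
    using assms(2) ab conn_step[of "snd H" u a b] conn_step[of "snd H" u b a] by (auto simp: insert_commute)
  ultimately show ?thesis using ab by auto
qed

text \<open>Deleting an edge \<open>e\<close> splits the forest into two vertex-disjoint parts,
  neither separating the plane by induction. Glueing \<open>e\<close> to the first at
  \<open>u\<close> and the second to the result at \<open>v\<close> are unions along one point,
  which Janiszewski's theorem allows.\<close>

lemma connected_forest_complement:
  "wf_sub H \<Longrightarrow> forest (snd H) \<Longrightarrow> connected (- D H)"
proof (induction "card (snd H)" arbitrary: H rule: less_induct)
  case less
  show ?case
  proof (cases "snd H = {}")
    case True
    then have "finite (D H)" using wf_sub_finite[OF less(2)] by (simp add: drawing_def)
    then show ?thesis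
      by (intro path_connected_imp_connected path_connected_complement_countable) (auto simp: countable_finite)
  next
    case False
    then obtain e where eH: "e \<in> snd H" by blast
    then have eG: "e \<in> snd G" using less wf_sub_edge by blast
    obtain u v where uv: "e = {u, v}" "u \<noteq> v" using edgeE[OF eG] by metis
    define H' where "H' = (fst H, snd H - {e})"
    define S where "S = {x \<in> fst H'. conn (snd H') u x}"
    define T1 where "T1 = (S, {d \<in> snd H'. d \<subseteq> S})"
    define T2 where "T2 = (fst H' - S, {d \<in> snd H'. d \<inter> S = {}})"
    have uvH: "u \<in> fst H" "v \<in> fst H" using less(2) eH uv by (auto simp: wf_sub_def)
    have uS: "u \<in> S" using uvH by (simp add: S_def H'_def)
    have vS: "v \<notin> S" using less(3) eH uv by (auto simp: S_def H'_def forest_def)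
    have wf': "wf_sub H'" using less(2) by (auto simp: wf_sub_def H'_def)
    have wfe: "wf_sub (e, {e})" using eG edge_subset[OF eG] by (auto simp: wf_sub_def)
    have S: "S \<subseteq> fst H'" "\<And>d. d \<in> snd H' \<Longrightarrow> d \<subseteq> S \<or> d \<inter> S = {}"
      using conn_edge_closed[OF wf'] by (auto simp: S_def)
    note split = wf_sub_split[OF wf' S] edges_split[OF wf' S] drawing_split[OF wf' S]
    have wf1: "wf_sub T1" and wf2: "wf_sub T2" and T12: "snd T1 \<inter> snd T2 = {}" and DH': "D H' = D T1 \<union> D T2"
      using split by (simp_all add: T1_def T2_def)
    have "connected (- D T1)" "connected (- D T2)"
    proof -
      have "finite (snd H)" using less(2) wf_sub_finite by blast
      then have "card (snd T1) < card (snd H)" "card (snd T2) < card (snd H)"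
        using eH by (auto intro!: psubset_card_mono simp: T1_def T2_def H'_def)
      moreover have "forest (snd T1)" "forest (snd T2)"
        by (rule forest_subset[OF less(3)]; auto simp: T1_def T2_def H'_def)+
      ultimately show "connected (- D T1)" "connected (- D T2)" using less(1) wf1 wf2 by blast+
    qed
    note con = this
    have ne: "{e} \<inter> snd T1 = {}" "{e} \<inter> snd T2 = {}" by (auto simp: T1_def T2_def H'_def)
    have c1: "connected (- (D T1 \<union> D (e, {e})))"
    proof (rule Janiszewski_connected)
      show "compact (D T1)" "closed (D (e, {e}))" using wf1 wfe compact_drawing closed_drawing by auto
      have "D T1 \<inter> D (e, {e}) = pos ` (S \<inter> e)"
        using drawing_inter[OF wf1 wfe] ne by (auto simp: T1_def)
      also have "S \<inter> e = {u}" using uS vS uv by auto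
      finally show "connected (D T1 \<inter> D (e, {e}))" by simp
      show "connected (- D (e, {e}))" using drawing_edge[OF eG] connected_arc_complement[OF arc_edge[OF eG]] by simp
    qed (rule con)
    have "connected (- (D (graph_union T1 (e, {e})) \<union> D T2))"
    proof (rule Janiszewski_connected)
      have wf12: "wf_sub (graph_union T1 (e, {e}))" using wf1 wfe wf_sub_union by blast
      show "compact (D (graph_union T1 (e, {e})))" "closed (D T2)" using wf2 wf12 compact_drawing closed_drawing by auto
      have "snd (graph_union T1 (e, {e})) \<inter> snd T2 = {}" using ne T12 by (auto simp: graph_union_def)
      then have "D (graph_union T1 (e, {e})) \<inter> D T2 = pos ` ((S \<union> e) \<inter> (fst H - S))"
        using drawing_inter[OF wf12 wf2] by (auto simp: T1_def T2_def H'_def graph_union_def)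
      also have "(S \<union> e) \<inter> (fst H - S) = {v}" using uS vS uv uvH by auto
      finally show "connected (D (graph_union T1 (e, {e})) \<inter> D T2)" by simp
      show "connected (- D (graph_union T1 (e, {e})))" using c1 by (simp add: drawing_union)
    qed (rule con)
    moreover have "D (graph_union T1 (e, {e})) \<union> D T2 = D H"
    proof -
      have "D H = D H' \<union> path_image (c e)" using eH by (auto simp: drawing_def H'_def)
      then show ?thesis using DH' drawing_edge[OF eG] by (auto simp: drawing_union)
    qed
    ultimately show ?thesis by simp
  qed
qed

text \<open>A nonempty perimeter separates the faces in \<open>A\<close> from the others, whereas
  the drawing of a forest leaves a connected complement.\<close>

lemma forest_bnd_empty:
  assumes "forest (bnd A)"
  shows "bnd A = {}"
proof (rule ccontr)
  assume "bnd A \<noteq> {}"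
  then obtain e where e: "e \<in> bnd A" by blast
  define H where "H = (fst G, bnd A)"
  have wf: "wf_sub H" using bnd_subset edge_subset by (auto simp: wf_sub_def H_def)
  have con: "connected (- D H)" using connected_forest_complement[OF wf] assms by (simp add: H_def)
  \<comment> \<open>Faces belonging to \<open>B\<close> are glued along the edges having no side
    outside \<open>B\<close>. Vertices are left out, as faces of both kinds may meet there; this is
    why \<open>H\<close> contains all vertices of \<open>G\<close>.\<close>
  define W where "W B = \<Union>(faces pos c G \<inter> B) \<union> \<Union>(edge_interior ` {e \<in> snd G. sides e \<subseteq> B})" for B
  have openW: "open (W B)" for B
  proof (subst open_contains_ball, intro ballI)
    fix x assume "x \<in> W B"
    then consider f where "f \<in> faces pos c G" "f \<in> B" "x \<in> f" | e where "e \<in> snd G" "sides e \<subseteq> B" "x \<in> edge_interior e"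
      unfolding W_def by blast
    then show "\<exists>r>0. ball x r \<subseteq> W B"
    proof cases
      case 1
      then obtain r where "r > 0" "ball x r \<subseteq> f" using open_face[OF wf_sub_G] openE by metis
      then show ?thesis using 1 unfolding W_def by blast
    next
      case 2
      obtain r where r: "r > 0" "ball x r - D G \<subseteq> \<Union>(sides e)" using near_edge_in_sides[OF 2(1,3)] .
      have "x \<in> - D (fst G, snd G - {e})"
        using edge_interior_drawing[OF 2(1) wf_sub_rest[OF 2(1)]] 2(3) by auto
      moreover have "open (- D (fst G, snd G - {e}))" using closed_drawing[OF wf_sub_rest[OF 2(1)]] by blast
      ultimately obtain s where s: "s > 0" "ball x s \<subseteq> - D (fst G, snd G - {e})" using openE by metis
      have "ball x (min r s) \<subseteq> W B"
      proof
        fix y assume "y \<in> ball x (min r s)"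
        then have y: "y \<in> ball x r" "y \<in> ball x s" by auto
        show "y \<in> W B"
        proof (cases "y \<in> D G")
          case True
          then have "y \<in> path_image (c e)" "y \<notin> pos ` fst G"
            using s(2) y(2) drawing_split_edge[OF 2(1)] by (auto simp: drawing_def)
          then have "y \<in> edge_interior e" using edge_subset[OF 2(1)] by (auto simp: edge_interior_def)
          then show ?thesis using 2 unfolding W_def by blast
        next
          case False
          then obtain f where "f \<in> sides e" "y \<in> f" using r y by blast
          then show ?thesis using 2 sides_face unfolding W_def by blast
        qed
      qed
      then show ?thesis using r(1) s(1) by (intro exI[of _ "min r s"]) simp
    qed
  qed
  have disj: "W A \<inter> W (- A) = {}"
  proof -
    have fe: "f \<inter> edge_interior e = {}" if "f \<in> faces pos c G" "e \<in> snd G" for f e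
    proof -
      have "edge_interior e \<subseteq> D G" using that by (auto simp: edge_interior_def drawing_def)
      then show ?thesis using face_disjoint_drawing[OF that(1)] by blast
    qed
    have ee: "edge_interior e \<inter> edge_interior e' = {}" if "e \<in> snd G" "e' \<in> snd G" "sides e \<subseteq> A" "sides e' \<subseteq> - A" for e e'
    proof -
      have "sides e \<noteq> {}" using sides_pair[OF that(1)] by (metis insert_not_empty)
      then have "e \<noteq> e'" using that by blast
      then show ?thesis using edge_interior_disjoint[OF that(1,2)] by (auto simp: edge_interior_def)
    qed
    have ff: "f \<inter> f' = {}" if "f \<in> faces pos c G" "f' \<in> faces pos c G" "f \<in> A" "f' \<notin> A" for f f'
      using faces_eq[OF that(1,2)] that by blast
    show ?thesis
    proof (rule ccontr)
      assume "W A \<inter> W (- A) \<noteq> {}"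
      then obtain x where x: "x \<in> W A" "x \<in> W (- A)" by blast
      have 1: "(\<exists>f\<in>faces pos c G. f \<in> A \<and> x \<in> f) \<or> (\<exists>e\<in>snd G. sides e \<subseteq> A \<and> x \<in> edge_interior e)"
        using x(1) unfolding W_def by blast
      have 2: "(\<exists>f\<in>faces pos c G. f \<notin> A \<and> x \<in> f) \<or> (\<exists>e\<in>snd G. sides e \<subseteq> - A \<and> x \<in> edge_interior e)"
        using x(2) unfolding W_def by blast
      from 1 2 show False
      proof (elim disjE bexE conjE)
        fix f f' assume "f \<in> faces pos c G" "f' \<in> faces pos c G" "f \<in> A" "f' \<notin> A" "x \<in> f" "x \<in> f'"
        then show False using ff[of f f'] by blast
      next
        fix f e assume "f \<in> faces pos c G" "e \<in> snd G" "x \<in> f" "x \<in> edge_interior e"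
        then show False using fe[of f e] by blast
      next
        fix f e assume "f \<in> faces pos c G" "e \<in> snd G" "x \<in> f" "x \<in> edge_interior e"
        then show False using fe[of f e] by blast
      next
        fix e e' assume "e \<in> snd G" "e' \<in> snd G" "sides e \<subseteq> A" "sides e' \<subseteq> - A"
          "x \<in> edge_interior e" "x \<in> edge_interior e'"
        then show False using ee[of e e'] by blast
      qed
    qed
  qed
  have cover: "- D H \<subseteq> W A \<union> W (- A)"
  proof
    fix x assume x: "x \<in> - D H"
    show "x \<in> W A \<union> W (- A)"
    proof (cases "x \<in> D G")
      case True
      moreover have "x \<notin> pos ` fst G" using x by (auto simp: drawing_def H_def)
      ultimately obtain d where d: "d \<in> snd G" "x \<in> edge_interior d"
        using drawing_eq[OF wf_sub_G] by blast
      then have "d \<notin> bnd A" using x by (auto simp: drawing_def H_def edge_interior_def)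
      then have "sides d \<subseteq> A \<or> sides d \<subseteq> - A" using d by (auto simp: bnd_def)
      then show ?thesis using d unfolding W_def by blast
    next
      case False
      then show ?thesis using point_in_face[OF False] unfolding W_def by blast
    qed
  qed
  obtain f f' where f: "f \<in> sides e" "f \<in> A" "f' \<in> sides e" "f' \<notin> A" using e by (auto simp: bnd_def)
  have sub: "D H \<subseteq> D G" using wf drawing_subset_G by blast
  have "W A \<inter> - D H \<noteq> {}"
    using f sides_face[OF f(1)] face_nonempty[of f G] face_disjoint_drawing[of f G] sub unfolding W_def by blast
  moreover have "W (- A) \<inter> - D H \<noteq> {}"
    using f sides_face[OF f(3)] face_nonempty[of f' G] face_disjoint_drawing[of f' G] sub unfolding W_def by blast
  ultimately show False
    using connectedD[OF con openW[of A] openW[of "- A"]] disj cover by blast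
qed

text \<open>A perimeter that is not a forest contains a cycle. Toggling the faces inside the cycle
  removes exactly its edges, and these meet every cut evenly, so induction applies to the smaller
  perimeter.\<close>

lemma even_cuts_bnd: "even_cuts (bnd A)"
proof (induction "card (bnd A)" arbitrary: A rule: less_induct)
  case less
  show ?case
  proof (cases "forest (bnd A)")
    case True
    then show ?thesis using forest_bnd_empty[OF True] by (simp add: even_cuts_def cut_edges_def)
  next
    case False
    then obtain u v where uv: "{u, v} \<in> bnd A" "conn (bnd A - {{u, v}}) u v" by (auto simp: forest_def)
    obtain H where H: "wf_sub H" "fst H = \<Union>(snd H)" "snd H \<subseteq> bnd A" "{u, v} \<in> snd H" "even_cuts (snd H)"
      "inside (D H) \<in> faces pos c H" "bnd (faces_in (inside (D H))) = snd H"
      using cycle_through_edge[OF bnd_subset uv] .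
    define I where "I = faces_in (inside (D H))"
    define Z where "Z = snd H"
    have bI: "bnd I = Z" and evZ: "even_cuts Z" and Z: "Z \<subseteq> bnd A" "Z \<noteq> {}"
      using H by (auto simp: I_def Z_def)
    define A' where "A' = A - I \<union> (I - A)"
    have b': "bnd A' = bnd A - Z" unfolding A'_def bnd_sym_diff bI using Z by blast
    then have "card (bnd A') < card (bnd A)" using Z finite_bnd by (intro psubset_card_mono) auto
    then have ev': "even_cuts (bnd A')" using less by blast
    have "bnd A = bnd A' - Z \<union> (Z - bnd A')" using b' Z by blast
    then show ?thesis
      using ev' evZ even_cut_sym_diff[of "bnd A'" Z] finite_bnd bI unfolding even_cuts_def by metis
  qed
qed

lemma shortest_path_even_cuts:
  fixes w :: "'v set \<Rightarrow> real"
  assumes w: "\<forall>e\<in>snd G. w e > 0" and p: "shortest_path G w p x y"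
    and Z: "Z \<subseteq> snd G" "even_cuts Z"
  shows "sum w (Z \<inter> walk_edges p) \<le> sum w (Z - walk_edges p)"
proof -
  define P where "P = walk_edges p"
  have pw: "walk G p" "distinct p" "hd p = x" "last p = y" "p \<noteq> []"
    using p by (auto simp: shortest_path_def walk_def)
  have PG: "P \<subseteq> snd G" using pw by (auto simp: P_def walk_def)
  have fin: "finite Z" "finite P" using Z finite_edges finite_subset by (auto simp: P_def)
  define M where "M = Z - P \<union> (P - Z)"
  \<comment> \<open>No edge of \<open>M\<close> leaves the component of \<open>x\<close>, and
    \<open>Z\<close> crosses this cut evenly; hence so does \<open>p\<close>, which puts
    \<open>y\<close> into the same component. The resulting path \<open>q\<close> in
    \<open>M\<close> competes with \<open>p\<close>, and cancelling the weight of
    \<open>P - Z\<close> gives the claim.\<close>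
  define S where "S = {v. conn M x v}"
  have MG: "M \<subseteq> snd G" using Z PG by (auto simp: M_def)
  have "cut_edges S M = {}"
  proof -
    have "e \<subseteq> S \<or> e \<inter> S = {}" if e: "e \<in> M" for e
    proof -
      obtain a b where ab: "e = {a, b}" using edgeE[of e] MG e by blast
      then have "conn M x a \<longleftrightarrow> conn M x b"
        using e conn_step[of M x a b] conn_step[of M x b a] by (auto simp: insert_commute)
      then show ?thesis using ab by (auto simp: S_def)
    qed
    then show ?thesis by (auto simp: cut_edges_def)
  qed
  then have "even (card (cut_edges S M))" by simp
  then have "even (card (cut_edges S P))"
    using even_cut_sym_diff[OF fin] Z(2) by (simp add: M_def even_cuts_def)
  then have "(x \<in> S) = (y \<in> S)" using cut_edges_path[of p S] pw by (simp add: P_def)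
  then have "conn M x y" by (simp add: S_def)
  moreover have "x \<in> fst G" using pw by (metis hd_in_set subsetD walk_def)
  ultimately obtain q where q: "walk G q" "distinct q" "hd q = x" "last q = y" "walk_edges q \<subseteq> M"
    using conn_path MG by blast
  then have "weight w p \<le> weight w q" using p q by (auto simp: shortest_path_def)
  then have "sum w P \<le> sum w (walk_edges q)" using pw q by (simp add: weight_distinct P_def)
  also have "\<dots> \<le> sum w M"
    using q(5) fin w MG by (intro sum_mono2) (auto simp: M_def less_imp_le subset_iff)
  also have "\<dots> = sum w (Z - P) + sum w (P - Z)"
    unfolding M_def using fin by (intro sum.union_disjoint) auto
  finally have "sum w P \<le> sum w (Z - P) + sum w (P - Z)" .
  moreover have "sum w P = sum w (Z \<inter> P) + sum w (P - Z)"
    using sum.Int_Diff[OF fin(2), of w Z] by (simp add: Int_commute)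
  ultimately show ?thesis by (simp add: P_def)
qed

end

section \<open>Incremental shortest paths subgraphs\<close>

context plane
begin

definition Out :: "complex set" where
  "Out = outside (D G)"

lemma Out_face: "Out \<in> faces pos c G"
  unfolding Out_def by (rule outside_in_faces[OF wf_sub_G])

lemma unbounded_Out: "\<not> bounded Out"
  unfolding Out_def by (rule unbounded_outside_drawing[OF wf_sub_G])

lemma outer_face_G: "outer_face pos c G = Out"
  by (simp add: Out_def outer_face_eq_outside)

text \<open>Removing edges can only enlarge the unbounded face, but to grow beyond
  \<open>Out\<close> it would have to cross the frontier of \<open>Out\<close>, which is drawn in
  \<open>H\<close>.\<close>

lemma face_eq_Out:
  assumes H: "wf_sub H" "frontier Out \<subseteq> D H" "F \<in> faces pos c H" "\<not> bounded F"
  shows "F = Out"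
proof -
  have F: "F = outside (D H)" using unbounded_face H by blast
  then have sub: "Out \<subseteq> F" unfolding Out_def using outside_mono drawing_subset_G H(1) by blast
  moreover have "F \<inter> frontier Out = {}" using face_disjoint_drawing[OF H(3)] H(2) by blast
  moreover have "F \<inter> Out \<noteq> {}" using sub face_nonempty[OF Out_face] by blast
  ultimately show ?thesis
    using connected_Int_frontier[of F Out] face_connected[OF H(3)] by blast
qed

lemma isp_wf_sub:
  assumes "isp G pos c w X"
  shows "wf_sub X \<and> subgraph (face_boundary pos c G Out) X"
  using assms
proof (induction rule: isp.induct)
  case isp_base
  then show ?case using wf_sub_face_boundary[OF wf_sub_G] by (simp add: outer_face_G subgraph_def)
next
  case (isp_step X x y p)
  then show ?case
    using wf_sub_union wf_sub_path_graph by (auto simp: subgraph_def graph_union_def shortest_path_def)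
qed

lemma isp_frontier_Out:
  assumes "isp G pos c w X"
  shows "frontier Out \<subseteq> D X"
proof -
  have "D (face_boundary pos c G Out) \<subseteq> D X"
    using isp_wf_sub[OF assms] by (intro drawing_mono) (auto simp: subgraph_def)
  then show ?thesis using frontier_face_eq[OF wf_sub_G Out_face] by simp
qed

text \<open>The outer boundary may fall apart when \<open>G\<close> does. Within one component of
  \<open>G\<close> it does not, since a component of the complement of the connected set
  \<open>Out\<close> has a connected frontier.\<close>

lemma outer_boundary_connected:
  assumes x: "x \<in> fst (face_boundary pos c G Out)" and y: "y \<in> fst (face_boundary pos c G Out)"
    and xy: "conn (snd G) x y"
  shows "conn (snd (face_boundary pos c G Out)) x y"
proof (rule ccontr)
  let ?X = "face_boundary pos c G Out"
  assume n: "\<not> conn (snd ?X) x y"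
  have xG: "x \<in> fst G" using x by (simp add: face_boundary_def)
  have ne: "x \<noteq> y" using n by auto
  obtain P where P: "walk G P" "distinct P" "hd P = x" "last P = y"
    using conn_path[OF xy order_refl xG] .
  obtain g where g: "arc g" "pathstart g = pos x" "pathfinish g = pos y" "path_image g = D (path_graph P)"
    using walk_arc[of P] P ne by auto
  have "path_image g \<subseteq> D G" using g drawing_subset_G[OF wf_sub_path_graph[OF P(1)]] by simp
  then have gO: "path_image g \<subseteq> - Out" using face_disjoint_drawing[OF Out_face] by blast
  have xyg: "pos x \<in> path_image g" "pos y \<in> path_image g" using g by (metis pathstart_in_path_image pathfinish_in_path_image)+
  define L where "L = connected_component_set (- Out) (pos x)"
  have L: "L \<in> components (- Out)" unfolding L_def using gO xyg by (intro componentsI) auto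
  have "path_image g \<subseteq> L"
    unfolding L_def using gO xyg connected_arc_image[OF g(1)] by (intro connected_component_maximal)
  then have xyL: "pos x \<in> L" "pos y \<in> L" using xyg by auto
  have "connected (frontier L)"
    using connected_frontier_component_complement[OF face_connected[OF Out_face] L] .
  moreover have "frontier L \<subseteq> D ?X"
    using frontier_of_components_subset[OF L] frontier_face_eq[OF wf_sub_G Out_face] by (simp add: frontier_complement)
  moreover have fr: "pos v \<in> frontier L" if "pos v \<in> L" "v \<in> fst ?X" for v
  proof -
    have "pos v \<in> closure Out" using that by (auto simp: face_boundary_def frontier_def)
    moreover have "Out \<subseteq> - L" using in_components_subset[OF L] by blast
    ultimately have "pos v \<in> closure (- L)" using closure_mono by blast
    then show ?thesis using that closure_subset by (auto simp: frontier_closures)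
  qed
  moreover
  \<comment> \<open>Splitting the boundary at the component of \<open>x\<close> gives two disjoint
    closed drawings that would both meet the connected set \<open>frontier L\<close>.\<close>
  define S where "S = {v \<in> fst ?X. conn (snd ?X) x v}"
  define T1 where "T1 = (S, {d \<in> snd ?X. d \<subseteq> S})"
  define T2 where "T2 = (fst ?X - S, {d \<in> snd ?X. d \<inter> S = {}})"
  have wf: "wf_sub ?X" by (rule wf_sub_face_boundary[OF wf_sub_G])
  have S: "S \<subseteq> fst ?X" "\<And>d. d \<in> snd ?X \<Longrightarrow> d \<subseteq> S \<or> d \<inter> S = {}"
    using conn_edge_closed[OF wf] by (auto simp: S_def)
  note split = wf_sub_split[OF wf S] edges_split[OF wf S] drawing_split[OF wf S]
  have wf1: "wf_sub T1" and wf2: "wf_sub T2" and T12: "snd T1 \<inter> snd T2 = {}" and DX: "D ?X = D T1 \<union> D T2"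
    using split by (simp_all add: T1_def T2_def)
  have "D T1 \<inter> D T2 = {}" using drawing_inter[OF wf1 wf2 T12] by (auto simp: T1_def T2_def)
  moreover have "pos x \<in> D T1" "pos y \<in> D T2"
    using x y n by (auto simp: drawing_def T1_def T2_def S_def)
  ultimately show False
    using connected_closedD[of "frontier L" "D T1" "D T2"] closed_drawing[OF wf1] closed_drawing[OF wf2] DX
      fr[OF xyL(1) x] fr[OF xyL(2) y] by blast
qed

text \<open>A new path starts in the old subgraph, so each of its vertices is tied to an old vertex.
  The point is that the two ends of the next path are already joined inside
  \<open>X\<close>.\<close>

lemma isp_connected:
  assumes "isp G pos c w X"
  shows "x \<in> fst X \<Longrightarrow> y \<in> fst X \<Longrightarrow> conn (snd G) x y \<Longrightarrow> conn (snd X) x y"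
  using assms
proof (induction arbitrary: x y rule: isp.induct)
  case isp_base
  then show ?case using outer_boundary_connected by (simp add: outer_face_G)
next
  case (isp_step X x y p a b)
  let ?X = "graph_union X (path_graph p)"
  have wf: "wf_sub X" using isp_wf_sub[OF isp_step.hyps(1)] by blast
  have pw: "walk G p" "hd p = x" "p \<noteq> []" using isp_step by (auto simp: shortest_path_def walk_def)
  have sX: "snd ?X = snd X \<union> walk_edges p" by (simp add: graph_union_def path_graph_def)
  have XG: "snd ?X \<subseteq> snd G" using wf pw unfolding sX by (auto simp: wf_sub_def walk_def)
  have near: "\<exists>z'\<in>fst X. conn (snd ?X) z z'" if z: "z \<in> fst ?X" for z
  proof (cases "z \<in> fst X")
    case False
    then have "z \<in> set p" using z by (simp add: graph_union_def path_graph_def)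
    then have "conn (snd ?X) x z" using conn_walk[of p "snd ?X" z] pw sX by auto
    then show ?thesis using isp_step.hyps(2) conn_sym[of "snd ?X" x z] by blast
  qed (auto intro: bexI[of _ z])
  obtain a' where a': "a' \<in> fst X" "conn (snd ?X) a a'" using near[OF isp_step.prems(1)] by blast
  obtain b' where b': "b' \<in> fst X" "conn (snd ?X) b b'" using near[OF isp_step.prems(2)] by blast
  have "conn (snd G) a' b'"
    using conn_mono[OF XG a'(2)] conn_mono[OF XG b'(2)] isp_step.prems(3) conn_trans conn_sym by meson
  then have "conn (snd X) a' b'" by (rule isp_step.IH[OF a'(1) b'(1)])
  then have "conn (snd ?X) a' b'" by (rule conn_mono[rotated]) (auto simp: sX)
  then show ?case using a' b' conn_trans conn_sym by meson
qed

text \<open>A new edge splits its path into two pieces leading to \<open>x\<close> and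
  \<open>y\<close>, and the old subgraph joins \<open>x\<close> to \<open>y\<close>; together they
  form a detour avoiding the edge.\<close>

lemma isp_edge_on_cycle:
  assumes "isp G pos c w X"
  shows "e \<in> snd X \<Longrightarrow> e \<in> snd (face_boundary pos c G Out) \<or> (\<exists>u v. e = {u, v} \<and> conn (snd X - {{u, v}}) u v)"
  using assms
proof (induction arbitrary: e rule: isp.induct)
  case isp_base
  then show ?case by (simp add: outer_face_G)
next
  case (isp_step X x y p)
  let ?X = "graph_union X (path_graph p)"
  have pw: "walk G p" "distinct p" "hd p = x" "last p = y" "p \<noteq> []"
    using isp_step by (auto simp: shortest_path_def walk_def)
  have sX: "snd ?X = snd X \<union> walk_edges p" by (simp add: graph_union_def path_graph_def)
  show ?case
  proof (cases "e \<in> snd X")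
    case True
    then show ?thesis using isp_step.IH[OF True] conn_mono[of "snd X - {e}" "snd ?X - {e}"] sX by blast
  next
    case False
    then have "e \<in> walk_edges p" using isp_step.prems sX by blast
    then obtain as a b bs where ab: "e = {a, b}" "p = as @ a # b # bs" using walk_edges_split by metis
    have "walk_edges p = walk_edges (as @ [a]) \<union> walk_edges (a # b # bs)"
      unfolding ab(2) by (rule walk_edges_append)
    then have sub: "walk_edges (as @ [a]) \<union> walk_edges (b # bs) \<subseteq> walk_edges p" by auto
    have "{a, b} \<notin> walk_edges (as @ [a])" "{a, b} \<notin> walk_edges (b # bs)"
      using pw(2) ab(2) walk_edges_subset[of "{a, b}" "as @ [a]"] walk_edges_subset[of "{a, b}" "b # bs"] by auto
    then have M: "walk_edges (as @ [a]) \<subseteq> snd ?X - {{a, b}}" "walk_edges (b # bs) \<subseteq> snd ?X - {{a, b}}"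
      using sub sX by auto
    have "hd (as @ [a]) = x" using pw ab by (cases as) auto
    then have xa: "conn (snd ?X - {{a, b}}) x a" using conn_walk[OF _ M(1), of a] by simp
    have "last (b # bs) = y" using pw ab by simp
    then have yb: "conn (snd ?X - {{a, b}}) b y" using conn_walk[OF _ M(2), of y] last_in_set[of "b # bs"] by simp
    have "conn (snd G) x y" using conn_walk[of p "snd G" y] pw last_in_set[of p] by (auto simp: walk_def)
    then have "conn (snd X) x y" using isp_connected[OF isp_step.hyps(1)] isp_step by blast
    then have "conn (snd ?X - {{a, b}}) x y" by (rule conn_mono[rotated]) (use False ab sX in auto)
    then have "conn (snd ?X - {{a, b}}) a b" using xa yb conn_trans conn_sym by meson
    then show ?thesis using ab by blast
  qed
qed

lemma Out_in_sides:
  assumes "e \<in> snd (face_boundary pos c G Out)"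
  shows "Out \<in> sides e"
proof -
  have e: "e \<in> snd G" "path_image (c e) \<subseteq> frontier Out" using assms by (auto simp: face_boundary_def)
  have "edge_interior e \<inter> frontier Out \<noteq> {}"
    using edge_interior_nonempty[OF e(1)] e(2) by (auto simp: edge_interior_def)
  then obtain f where f: "f \<in> sides e" "f \<in> faces_in Out"
    using side_within_face[OF wf_sub_G Out_face e(1)] by blast
  then have "f = Out"
    using faces_eq[OF sides_face[OF f(1)] Out_face] face_nonempty[OF sides_face[OF f(1)]] unfolding faces_in_def by blast
  then show ?thesis using f by simp
qed

text \<open>An edge on the outer boundary has the unbounded side \<open>Out\<close>. An edge on a
  cycle of \<open>X\<close> has sides both within and outside the Jordan domain of that cycle, and
  \<open>F\<close>, being connected and disjoint from the cycle, cannot contain both.\<close>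

lemma isp_no_bridge:
  assumes X: "isp G pos c w X" and e: "e \<in> snd X" and F: "F \<in> faces pos c X" "bounded F"
  shows "\<not> sides e \<subseteq> faces_in F"
proof
  assume sub: "sides e \<subseteq> faces_in F"
  have wf: "wf_sub X" using isp_wf_sub[OF X] by blast
  consider "e \<in> snd (face_boundary pos c G Out)" | u v where "e = {u, v}" "conn (snd X - {{u, v}}) u v"
    using isp_edge_on_cycle[OF X e] by blast
  then show False
  proof cases
    case 1
    then have "Out \<subseteq> F" using Out_in_sides sub by (auto simp: faces_in_def)
    then show False using F(2) unbounded_Out bounded_subset by blast
  next
    case 2
    have XG: "snd X \<subseteq> snd G" using wf by (simp add: wf_sub_def)
    obtain H where H: "wf_sub H" "fst H = \<Union>(snd H)" "snd H \<subseteq> snd X" "{u, v} \<in> snd H" "even_cuts (snd H)"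
      "inside (D H) \<in> faces pos c H" "bnd (faces_in (inside (D H))) = snd H"
      using cycle_through_edge[OF XG _ 2(2)] e 2(1) by blast
    then have "e \<in> bnd (faces_in (inside (D H)))" using 2(1) by simp
    then obtain f g where fg: "f \<in> sides e" "f \<subseteq> inside (D H)" "g \<in> sides e" "\<not> g \<subseteq> inside (D H)"
      using sides_face by (auto simp: bnd_def faces_in_def)
    have "fst H \<subseteq> fst X" using H(2) Union_mono[OF H(3)] wf unfolding wf_sub_def by blast
    then have "D H \<subseteq> D X" using H(3) by (rule drawing_mono)
    then have "F \<inter> D H = {}" using face_disjoint_drawing[OF F(1)] by blast
    moreover have "F \<inter> inside (D H) \<noteq> {}"
      using fg(1,2) sub face_nonempty[OF sides_face[OF fg(1)]] unfolding faces_in_def by blast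
    ultimately have "F \<subseteq> inside (D H)" using face_absorbs[OF H(6) face_connected[OF F(1)]] by blast
    then show False using fg(3,4) sub unfolding faces_in_def by blast
  qed
qed

text \<open>The set \<open>B\<close> is arbitrary so that the hypothesis for the old face
  \<open>F'\<close> can be used with \<open>B\<close> enlarged by \<open>F'\<close>. In the base
  case every perimeter edge of \<open>F\<close> borders \<open>Out\<close>, so no admissible
  \<open>B\<close> can absorb it.\<close>

lemma isp_face_minimal_perimeter:
  fixes w :: "'v set \<Rightarrow> real"
  assumes w: "\<forall>e\<in>snd G. w e > 0" and X: "isp G pos c w X"
  shows "F \<in> faces pos c X \<Longrightarrow> bounded F \<Longrightarrow> faces_in F \<subseteq> B \<Longrightarrow> Out \<notin> B
    \<Longrightarrow> sum w (bnd (faces_in F)) \<le> sum w (bnd B)"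
  using X
proof (induction arbitrary: F B rule: isp.induct)
  case isp_base
  let ?X = "face_boundary pos c G Out"
  have F: "F \<in> faces pos c ?X" using isp_base by (simp add: outer_face_G)
  have "bnd (faces_in F) \<subseteq> bnd B"
  proof
    fix e assume e: "e \<in> bnd (faces_in F)"
    then have "Out \<in> sides e" using bnd_faces_in(1)[OF wf_sub_face_boundary[OF wf_sub_G] F] Out_in_sides by blast
    then show "e \<in> bnd B" using e isp_base by (auto simp: bnd_def)
  qed
  then show ?case using w bnd_subset finite_bnd by (intro sum_mono2) (auto simp: less_imp_le subset_iff)
next
  case (isp_step X x y p)
  let ?X = "graph_union X (path_graph p)"
  have X': "isp G pos c w ?X" using isp_step.hyps isp.isp_step by metis
  have wf: "wf_sub X" and wf': "wf_sub ?X" using isp_wf_sub[OF isp_step.hyps(1)] isp_wf_sub[OF X'] by auto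
  have sX: "snd ?X = snd X \<union> walk_edges p" by (simp add: graph_union_def path_graph_def)
  have F: "F \<in> faces pos c ?X" "bounded F" using isp_step by auto
  obtain z where z: "z \<in> F" using face_nonempty[OF F(1)] by blast
  have FX: "F \<inter> D X = {}" using face_disjoint_drawing[OF F(1)] by (auto simp: drawing_union)
  then obtain F' where F': "F' \<in> faces pos c X" "z \<in> F'" using point_in_face[of z X] z by blast
  have FF': "F \<subseteq> F'" using face_absorbs[OF F'(1) face_connected[OF F(1)] FX] z F'(2) by blast
  \<comment> \<open>An unbounded \<open>F'\<close> would be \<open>Out\<close>, which the new path
    does not enter; then the bounded \<open>F\<close> would contain \<open>Out\<close>.\<close>
  have bF': "bounded F'"
  proof (rule ccontr)
    assume "\<not> bounded F'"
    then have "F' = Out" using face_eq_Out[OF wf isp_frontier_Out[OF isp_step.hyps(1)] F'(1)] by blast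
    then have "Out \<inter> F \<noteq> {}" using z F'(2) by blast
    moreover have "Out \<inter> D ?X = {}" using face_disjoint_drawing[OF Out_face] drawing_subset_G[OF wf'] by blast
    ultimately have "Out \<subseteq> F" using face_absorbs[OF F(1) face_connected[OF Out_face]] by blast
    then show False using F(2) unbounded_Out bounded_subset by blast
  qed
  have OF': "Out \<notin> faces_in F'" using bF' unbounded_Out bounded_subset unfolding faces_in_def by blast
  define R where "R = faces_in F"
  define B1 where "B1 = B \<inter> faces_in F'"
  have RB1: "R \<subseteq> B1" using isp_step.prems(3) FF' by (auto simp: R_def B1_def faces_in_def)
  \<comment> \<open>Minimality of \<open>F'\<close> bounds the union term of the submodular
    inequality from below, which leaves the comparison of \<open>B1\<close> with
    \<open>B\<close>.\<close>
  have "sum w (bnd (faces_in F')) \<le> sum w (bnd (B \<union> faces_in F'))"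
    using isp_step.IH[OF F'(1) bF', of "B \<union> faces_in F'"] isp_step.prems(4) OF' by blast
  then have 1: "sum w (bnd B1) \<le> sum w (bnd B)"
    using bnd_submodular[OF w, of B "faces_in F'"] by (simp add: B1_def)
  define b where "b = bnd R"
  define Z where "Z = bnd (B1 - R)"
  have fin: "finite b" "finite Z" by (auto simp: b_def Z_def finite_bnd)
  have "B1 = R - (B1 - R) \<union> ((B1 - R) - R)" using RB1 by blast
  then have B1: "bnd B1 = b - Z \<union> (Z - b)" using bnd_sym_diff[of R "B1 - R"] by (simp add: b_def Z_def)
  \<comment> \<open>A shared edge is not on the perimeter of \<open>B1\<close> but has a side in it,
    so all its sides are in \<open>B1\<close> and hence in \<open>F'\<close>; for an old edge this
    is impossible.\<close>
  have bZ: "b \<inter> Z \<subseteq> walk_edges p"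
  proof
    fix e assume e: "e \<in> b \<inter> Z"
    then have eG: "e \<in> snd G" using bnd_subset by (auto simp: b_def)
    show "e \<in> walk_edges p"
    proof (rule ccontr)
      assume "e \<notin> walk_edges p"
      moreover have "e \<in> snd ?X" using bnd_faces_in(1)[OF wf' F(1)] e by (auto simp: b_def R_def)
      ultimately have eX: "e \<in> snd X" using sX by blast
      have "e \<notin> bnd B1" using B1 e by blast
      moreover have "sides e \<inter> B1 \<noteq> {}" using e RB1 by (auto simp: b_def bnd_def)
      ultimately have "sides e \<subseteq> B1" using eG by (auto simp: bnd_def)
      then show False using isp_no_bridge[OF isp_step.hyps(1) eX F'(1) bF'] by (auto simp: B1_def)
    qed
  qed
  have pos: "0 \<le> w e" if "e \<in> Z" for e using that w bnd_subset by (auto simp: Z_def less_imp_le subset_iff)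
  have "sum w (b \<inter> Z) \<le> sum w (Z \<inter> walk_edges p)"
    using bZ fin pos by (intro sum_mono2) auto
  also have "\<dots> \<le> sum w (Z - walk_edges p)"
    using shortest_path_even_cuts[OF w isp_step.hyps(4), of Z] bnd_subset even_cuts_bnd by (simp add: Z_def)
  also have "\<dots> \<le> sum w (Z - b)"
    using bZ fin pos by (intro sum_mono2) auto
  finally have "sum w (b \<inter> Z) \<le> sum w (Z - b)" .
  moreover have "sum w b = sum w (b \<inter> Z) + sum w (b - Z)" using sum.Int_Diff[OF fin(1), of w Z] .
  moreover have "sum w (bnd B1) = sum w (b - Z) + sum w (Z - b)"
    unfolding B1 using fin by (intro sum.union_disjoint) auto
  ultimately show ?case using 1 by (simp add: b_def R_def)
qed

section \<open>Excursions and their replacements\<close>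

lemma face_outside_boundary:
  assumes H: "wf_sub H" "F \<in> faces pos c H" "bounded F"
  shows "F \<inter> outside (D (face_boundary pos c H F)) = {}"
proof (rule ccontr)
  let ?O = "outside (D (face_boundary pos c H F))"
  assume "F \<inter> ?O \<noteq> {}"
  have wf: "wf_sub (face_boundary pos c H F)" by (rule wf_sub_face_boundary[OF H(1)])
  have O: "?O \<in> faces pos c (face_boundary pos c H F)" by (rule outside_in_faces[OF wf])
  have "?O \<inter> frontier F = {}"
    using face_disjoint_drawing[OF O] frontier_face_eq[OF H(1,2)] by simp
  then have "?O \<subseteq> F"
    using connected_Int_frontier[OF face_connected[OF O], of F] \<open>F \<inter> ?O \<noteq> {}\<close> by blast
  then show False using H(3) unbounded_outside_drawing[OF wf] bounded_subset by blast
qed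

text \<open>The set competing with \<open>F\<close> is \<open>F\<close> plus the inside of the cycle
  formed by \<open>mu\<close> and \<open>q\<close>. The work is to show that this inside is disjoint
  from \<open>F\<close> and that the two perimeters overlap exactly in \<open>mu\<close>.\<close>

lemma excursion_weight:
  fixes w :: "'v set \<Rightarrow> real"
  assumes w: "\<forall>e\<in>snd G. w e > 0" and X: "isp G pos c w X" and F: "F \<in> faces pos c X"
  defines "C \<equiv> face_boundary pos c X F"
  assumes q: "walk G q" "distinct q" "hd q = u" "last q = v" "u \<noteq> v"
    and out: "set q \<inter> fst (region G pos c C) \<subseteq> {u, v}" "walk_edges q \<inter> snd (region G pos c C) = {}"
    and mu: "walk C mu" "distinct mu" "hd mu = u" "last mu = v"
    and nsub: "\<not> subgraph (region G pos c C) (region G pos c (graph_union (path_graph mu) (path_graph q)))"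
  shows "weight w mu \<le> weight w q"
proof -
  have wf: "wf_sub X" using isp_wf_sub[OF X] by blast
  have wfC: "wf_sub C" unfolding C_def by (rule wf_sub_face_boundary[OF wf])
  have CX: "fst C \<subseteq> fst X" "snd C \<subseteq> snd X" by (auto simp: C_def face_boundary_def)
  have DC: "D C = frontier F" unfolding C_def by (rule frontier_face_eq[OF wf F])
  have Creg: "fst C \<subseteq> fst (region G pos c C)" "snd C \<subseteq> snd (region G pos c C)"
  proof -
    have "pos ` fst C \<subseteq> D C" "\<And>e. e \<in> snd C \<Longrightarrow> path_image (c e) \<subseteq> D C" by (auto simp: drawing_def)
    then have "pos ` fst C \<inter> outside (D C) = {}" "\<And>e. e \<in> snd C \<Longrightarrow> path_image (c e) \<inter> outside (D C) = {}"
      using outside_no_overlap[of "D C"] by blast+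
    then show "fst C \<subseteq> fst (region G pos c C)" "snd C \<subseteq> snd (region G pos c C)"
      using wfC by (auto simp: region_def outer_face_eq_outside wf_sub_def)
  qed
  have qmeets: "path_image (c e) \<inter> outside (D C) \<noteq> {}" "e \<in> snd G" if "e \<in> walk_edges q" for e
    using that out(2) walk_edge[OF q(1)] by (auto simp: region_def outer_face_eq_outside)
  \<comment> \<open>The unbounded face admits no excursion: it would be \<open>Out\<close>, the
    outside of its own boundary, and no edge of \<open>G\<close> enters \<open>Out\<close>.\<close>
  have bF: "bounded F"
  proof (rule ccontr)
    assume "\<not> bounded F"
    then have "F = Out" using face_eq_Out[OF wf isp_frontier_Out[OF X] F] by blast
    then have "frontier Out \<subseteq> D C" using DC by simp
    then have "outside (D C) = Out"
      using face_eq_Out[OF wfC _ outside_in_faces[OF wfC] unbounded_outside_drawing[OF wfC]] by blast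
    moreover obtain e where e: "e \<in> walk_edges q"
      using q by (cases q; cases "tl q") (auto simp: walk_def)
    ultimately have "path_image (c e) \<inter> Out \<noteq> {}" using qmeets by blast
    moreover have "path_image (c e) \<subseteq> D G" using qmeets[OF e] by (auto simp: drawing_def)
    ultimately show False using face_disjoint_drawing[OF Out_face] by blast
  qed
  have muG: "walk G mu" using mu(1) wfC by (auto simp: walk_def wf_sub_def)
  have qne: "q \<noteq> []" "mu \<noteq> []" using q mu by (auto simp: walk_def)
  have int: "set mu \<inter> set q = {u, v}"
  proof -
    have "set mu \<subseteq> fst (region G pos c C)" using mu(1) Creg by (auto simp: walk_def)
    moreover have "u \<in> set mu" "v \<in> set mu" "u \<in> set q" "v \<in> set q"
      using hd_in_set last_in_set qne q mu by metis+
    ultimately show ?thesis using out(1) by blast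
  qed
  have muC: "walk_edges mu \<subseteq> snd C" using mu(1) by (simp add: walk_def)
  have ed: "walk_edges mu \<inter> walk_edges q = {}" using muC Creg out(2) by blast
  define H where "H = graph_union (path_graph mu) (path_graph q)"
  note J = cycle_Jordan[OF muG mu(2-4) q(1-4) q(5) int ed, folded H_def]
  have wfH: "wf_sub H" unfolding H_def using wf_sub_union wf_sub_path_graph muG q(1) by blast
  have Fo: "F \<inter> outside (D C) = {}" unfolding C_def by (rule face_outside_boundary[OF wf F bF])
  have openF: "open F" by (rule open_face[OF wf F])
  \<comment> \<open>An edge of \<open>q\<close> avoids the drawing of \<open>C\<close> except at its
    ends and reaches its outside, so its interior lies entirely there, away from
    \<open>F\<close>.\<close>
  have Fq: "F \<inter> path_image (c e) = {}" if e: "e \<in> walk_edges q" for e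
  proof -
    note eG = qmeets(2)[OF e]
    have "e \<notin> snd C" using e out(2) Creg by blast
    then have "edge_interior e \<inter> D C = {}" using edge_interior_drawing[OF eG wfC] by blast
    moreover have "edge_interior e \<inter> outside (D C) \<noteq> {}"
    proof -
      have "open (outside (D C))" using open_face[OF wfC outside_in_faces[OF wfC]] .
      then show ?thesis
        using qmeets(1)[OF e] closure_edge_interior[OF eG] open_Int_closure_eq_empty[of "outside (D C)" "edge_interior e"] by blast
    qed
    ultimately have "edge_interior e \<subseteq> outside (D C)"
      using face_absorbs[OF outside_in_faces[OF wfC] connected_edge_interior[OF eG]] by blast
    then have "F \<inter> edge_interior e = {}" using Fo by blast
    then have "F \<inter> closure (edge_interior e) = {}" using openF open_Int_closure_eq_empty by blast
    then show ?thesis using closure_edge_interior[OF eG] by blast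
  qed
  have FH: "F \<inter> D H = {}"
  proof -
    have "2 \<le> length q" using q qne by (cases q; cases "tl q") auto
    then have "D (path_graph q) = (\<Union>e\<in>walk_edges q. path_image (c e))"
      using drawing_eq[OF wf_sub_path_graph[OF q(1)]] set_eq_Union_walk_edges[of q] path_image_edge walk_edge[OF q(1)]
      by (auto simp: path_graph_def drawing_def)
    then have "F \<inter> D (path_graph q) = {}" using Fq by blast
    moreover have "D (path_graph mu) \<subseteq> D X"
      using muC mu(1) CX by (intro drawing_mono) (auto simp: path_graph_def walk_def)
    then have "F \<inter> D (path_graph mu) = {}" using face_disjoint_drawing[OF F] by blast
    ultimately show ?thesis by (auto simp: H_def drawing_union)
  qed
  \<comment> \<open>This is where the choice of \<open>mu\<close> enters: if \<open>F\<close> were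
    inside the new cycle, the outside of that cycle would lie in the outside of \<open>C\<close>,
    and the region of \<open>C\<close> would be contained in the region of the cycle.\<close>
  have Fin: "F \<inter> inside (D H) = {}"
  proof (rule ccontr)
    assume "F \<inter> inside (D H) \<noteq> {}"
    then have "F \<subseteq> inside (D H)" using face_absorbs[OF J(1) face_connected[OF F] FH] by blast
    then have "closure F \<subseteq> inside (D H) \<union> D H"
      using closure_mono[of F "inside (D H)"] J(3) by (auto simp: closure_Un_frontier)
    then have "D C \<subseteq> inside (D H) \<union> D H" using DC by (auto simp: frontier_def)
    then have disj: "outside (D H) \<inter> D C = {}" using inside_Int_outside[of "D H"] outside_no_overlap[of "D H"] by blast
    obtain K where K: "K \<in> faces pos c C" "outside (D H) \<subseteq> K"
    proof -
      obtain z where z: "z \<in> outside (D H)" using face_nonempty[OF J(2)] by blast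
      then obtain K where "K \<in> faces pos c C" "z \<in> K" using point_in_face[of z C] disj by blast
      then show thesis using that face_absorbs[of K C "outside (D H)"] face_connected[OF J(2)] disj z by blast
    qed
    have "\<not> bounded K" using K(2) unbounded_outside_drawing[OF wfH] bounded_subset by blast
    then have "outside (D H) \<subseteq> outside (D C)" using unbounded_face[OF wfC K(1)] K(2) by blast
    then have "subgraph (region G pos c C) (region G pos c H)"
      unfolding subgraph_def region_def outer_face_eq_outside by auto
    then show False using nsub by (simp add: H_def)
  qed
  define A where "A = faces_in (inside (D H))"
  define R where "R = faces_in F"
  have bA: "bnd A = walk_edges mu \<union> walk_edges q" using J(6) by (simp add: A_def)
  have AR: "A \<inter> R = {}" using Fin face_nonempty[of _ G] unfolding A_def R_def faces_in_def by blast
  have "Out \<notin> A \<union> R"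
    using unbounded_Out bF J(5) bounded_subset unfolding A_def R_def faces_in_def by blast
  then have le: "sum w (bnd R) \<le> sum w (bnd (A \<union> R))"
    using isp_face_minimal_perimeter[OF w X F bF, of "A \<union> R"] by (simp add: R_def)
  have "A \<union> R = A - R \<union> (R - A)" using AR by blast
  then have bAR: "bnd (A \<union> R) = bnd A - bnd R \<union> (bnd R - bnd A)" using bnd_sym_diff by metis
  \<comment> \<open>An edge of \<open>mu\<close> has a side in \<open>F\<close>, being on its
    frontier, and a side in \<open>A\<close>, being on the cycle; as \<open>A\<close> and
    \<open>R\<close> are disjoint it is no bridge.\<close>
  have muR: "walk_edges mu \<subseteq> bnd R"
  proof
    fix e assume e: "e \<in> walk_edges mu"
    then have eG: "e \<in> snd G" using walk_edge[OF muG] by blast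
    have "path_image (c e) \<subseteq> frontier F" using e muC by (auto simp: C_def face_boundary_def)
    then have "edge_interior e \<inter> frontier F \<noteq> {}"
      using edge_interior_nonempty[OF eG] by (auto simp: edge_interior_def)
    then obtain f where f: "f \<in> sides e" "f \<in> R" using side_within_face[OF wf F eG] by (auto simp: R_def)
    obtain g where g: "g \<in> sides e" "g \<in> A" using e bA by (auto simp: bnd_def)
    then show "e \<in> bnd R" using f g eG AR by (auto simp: bnd_def)
  qed
  have qR: "walk_edges q \<inter> bnd R = {}"
  proof -
    have "e \<in> snd C" if "e \<in> bnd R" for e
      using bnd_faces_in[OF wf F] that by (auto simp: R_def C_def face_boundary_def)
    then show ?thesis using Creg out(2) by blast
  qed
  have "bnd (A \<union> R) = walk_edges q \<union> (bnd R - walk_edges mu)"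
    unfolding bAR bA using muR qR by blast
  then have "sum w (bnd (A \<union> R)) = sum w (walk_edges q) + sum w (bnd R - walk_edges mu)"
    using qR finite_bnd by (simp only:) (intro sum.union_disjoint, auto)
  moreover have "sum w (bnd R) = sum w (walk_edges mu) + sum w (bnd R - walk_edges mu)"
    using sum.subset_diff[OF muR finite_bnd, of w] by simp
  ultimately show ?thesis using le q mu by (simp add: weight_distinct)
qed

end

text \<open>The invariant \<open>hd \<rho> = hd \<pi>\<close> is carried along because it makes the
  replaced pieces fit together; distinctness of the path ensures \<open>u \<noteq> v\<close> for
  each excursion.\<close>

lemma down_weight:
  fixes G :: "'v graph" and w :: "'v set \<Rightarrow> real"
  assumes G: "plane_graph G pos c" and w: "\<forall>e\<in>snd G. w e > 0"
    and X: "isp G pos c w X" and F: "F \<in> faces pos c X"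
    and "down G pos c (face_boundary pos c X F) \<pi> \<rho>"
  shows "walk G \<pi> \<Longrightarrow> distinct \<pi> \<Longrightarrow> \<rho> \<noteq> [] \<and> hd \<rho> = hd \<pi> \<and> weight w \<rho> \<le> weight w \<pi>"
  using assms(5)
proof (induction rule: down.induct)
  case (down_in u v rest \<rho>)
  then have "\<rho> \<noteq> []" "hd \<rho> = v" "weight w \<rho> \<le> weight w (v # rest)" by (auto simp: walk_def)
  then show ?case by (cases \<rho>) auto
next
  case (down_out u v out mu rest \<rho>)
  interpret plane G pos c by (unfold_locales) (rule G)
  let ?q = "u # out @ [v]"
  have we: "walk_edges (u # out @ v # rest) = walk_edges ?q \<union> walk_edges (v # rest)"
    using walk_edges_append[of "u # out" v rest] by simp
  have wq: "walk G ?q" "distinct ?q" and wr: "walk G (v # rest)" "distinct (v # rest)"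
    using down_out.prems unfolding walk_def we by auto
  have "weight w mu \<le> weight w ?q"
    by (rule excursion_weight[OF w X F wq(1,2) _ _ _ _ _ _ _ _ _ down_out.hyps(9)])
       (use down_out.hyps wq in auto)
  moreover have \<rho>: "\<rho> \<noteq> []" "hd \<rho> = v" "weight w \<rho> \<le> weight w (v # rest)" using down_out.IH wr by auto
  moreover have "mu \<noteq> []" using down_out.hyps by (auto simp: walk_def)
  \<comment> \<open>\<open>tl\<close> drops the copy of \<open>v\<close> at the head of
    \<open>\<rho>\<close>, which \<open>mu\<close> already supplies as its last vertex; so no edge
    is lost at the junction.\<close>
  moreover have "weight w (mu @ tl \<rho>) = weight w mu + weight w \<rho>"
  proof -
    have "mu = butlast mu @ [v]" using down_out.hyps \<open>mu \<noteq> []\<close> by (metis append_butlast_last_id)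
    moreover have "\<rho> = v # tl \<rho>" using \<rho> by (cases \<rho>) auto
    ultimately show ?thesis using weight_append[of w "butlast mu" v "tl \<rho>"] by (metis append.assoc append_Cons append_Nil)
  qed
  moreover have "weight w (u # out @ v # rest) = weight w ?q + weight w (v # rest)"
    using weight_append[of w "u # out" v rest] by simp
  ultimately show ?case using down_out.hyps by auto
qed (auto simp: weight_def)

theorem theorem1:
  fixes G :: "'v graph" and pos :: "'v \<Rightarrow> complex" and c :: "'v set \<Rightarrow> real \<Rightarrow> complex"
    and w :: "'v set \<Rightarrow> real" and X :: "'v graph" and F :: "complex set"
    and a b :: 'v and \<pi> :: "'v list"
  assumes "plane_graph G pos c"
    and "\<forall>e\<in>snd G. w e > 0"
    and "isp G pos c w X"
    and "F \<in> faces pos c X"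
    and "a \<in> fst (region G pos c (face_boundary pos c X F))"
    and "b \<in> fst (region G pos c (face_boundary pos c X F))"
    and "a \<noteq> b"
    and "walk G \<pi>" and "distinct \<pi>" and "hd \<pi> = a" and "last \<pi> = b"
  shows "\<forall>\<rho>. down G pos c (face_boundary pos c X F) \<pi> \<rho> \<longrightarrow> weight w \<rho> \<le> weight w \<pi>"
  using down_weight[OF assms(1-4)] assms(8,9) by blast

end
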